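(* Let $\tau=\{t_j\}_{j=1}^{\infty}$ be a sequence of real numbers with $t_j\in[0,1]$ for all $j$. The following conditions are equivalent: 1) the weak greedy algorithm with weakness sequence $\tau$ converges; 2) the series $$\sum_{n=0}^{\infty}\Bigl(2^{-n}\sum_{k=2^n}^{2^{n+1}-1}t_k^2\Bigr)^{1/2}$$ diverges; 3) the series $$\sum_{n=1}^{\infty}\Bigl(1+n\sum_{k=1}^{n}t_k^2\Bigr)^{-1/2}t_n^2$$ diverges; 4) the series $$\sum_{n=1}^{\infty}\frac{1}{\sqrt{n}}\Bigl(\Bigl(\sum_{k=1}^{n}t_k^2\Bigr)^{1/2}-\Bigl(\sum_{k=1}^{n-1}t_k^2\Bigr)^{1/2}\Bigr)$$ diverges.
   Context: Empty sums equal $0$. Dictionary: for a Hilbert space $H$, a dictionary is a set $\mathcal{D}\subset\{g\in H:\|g\|=1\}$ with $\overline{\operatorname{span}}\,\mathcal{D}=H$. Weak greedy algorithm: let $\tau=\{t_k\}_{k=1}^{\infty}$ with $0\le t_k\le 1$ be a weakness sequence, $H$ a Hilbert space, $\mathcal{D}$ a dictionary in $H$, and $f\in H$. Set $f_0^{\tau}=f$. For each $n\in\mathbb{N}=\{1,2,\dots\}$, recursively choose an element $\phi_n^{\tau}\in\mathcal{D}$ such that $$|\langle f_{n-1}^{\tau},\phi_n^{\tau}\rangle|\ge t_n\sup_{g\in\mathcal{D}}|\langle f_{n-1}^{\tau},g\rangle|,$$ and define $$f_n^{\tau}=f_{n-1}^{\tau}-\langle f_{n-1}^{\tau},\phi_n^{\tau}\rangle\phi_n^{\tau},\qquad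 G_n^{\tau}(f,\mathcal{D})=\sum_{j=1}^{n}\langle f_{j-1}^{\tau},\phi_j^{\tau}\rangle\phi_j^{\tau}.$$ Convergence: for a given sequence $\tau$ with $t_k\in[0,1]$, the weak greedy algorithm (WGA) converges if for every Hilbert space $H$, every dictionary $\mathcal{D}$ in $H$, every $f\in H$, and every possible choice of the vectors $\phi_n^{\tau}\in\mathcal{D}$ satisfying $|\langle f_{n-1}^{\tau},\phi_n^{\tau}\rangle|\ge t_n\sup_{g\in\mathcal{D}}|\langle f_{n-1}^{\tau},g\rangle|$ for all $n\in\mathbb{N}$ (where $f_0^{\tau}=f$ and $f_n^{\tau}=f_{n-1}^{\tau}-\langle f_{n-1}^{\tau},\phi_n^{\tau}\rangle\phi_n^{\tau}$), $G_n^{\tau}(f,\mathcal{D})\to f$ in $H$ as $n\to\infty$. *)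

theory Defs
  imports "HOL-Analysis.Analysis" "HOL-Algebra.Module"
begin

text \<open>
  Convergence of the weak greedy algorithm quantifies over all Hilbert spaces, and HOL cannot
  quantify over types inside a proposition.  Hence Hilbert spaces are carrier-based here: the
  underlying set, the vector space operations and the inner product are all arbitrary, and only
  the ambient type \<open>'a\<close> of the vectors is fixed.  The scalars are the subfield
  \<open>K\<close> of the complex numbers, which is either the set of reals or everything, so that
  real and complex Hilbert spaces are treated at once.
\<close>

definition scalar_field :: "complex set \<Rightarrow> complex ring" where
  "scalar_field K = \<lparr>carrier = K, monoid.mult = (*), one = 1, zero = 0, add = (+)\<rparr>"

locale inner_product_space = Module.module "scalar_field K" H
  for K :: "complex set" and H :: "(complex, 'a) module" (structure) +
  fixes ip :: "'a \<Rightarrow> 'a \<Rightarrow> complex"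
  assumes scalars: "K = \<real> \<or> K = UNIV"
    and ip_closed: "\<lbrakk>x \<in> carrier H; y \<in> carrier H\<rbrakk> \<Longrightarrow> ip x y \<in> K"
    and ip_commute: "\<lbrakk>x \<in> carrier H; y \<in> carrier H\<rbrakk> \<Longrightarrow> ip x y = cnj (ip y x)"
    and ip_add_left: "\<lbrakk>x \<in> carrier H; y \<in> carrier H; z \<in> carrier H\<rbrakk>
          \<Longrightarrow> ip (x \<oplus> y) z = ip x z + ip y z"
    and ip_smult_left: "\<lbrakk>a \<in> K; x \<in> carrier H; y \<in> carrier H\<rbrakk> \<Longrightarrow> ip (a \<odot> x) y = a * ip x y"
    and ip_pos: "\<lbrakk>x \<in> carrier H; x \<noteq> \<zero>\<rbrakk> \<Longrightarrow> 0 < Re (ip x x)"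
begin

definition hnorm :: "'a \<Rightarrow> real" where
  "hnorm x = sqrt (Re (ip x x))"

text \<open>The value outside the carrier is irrelevant, but \<^locale>\<open>Metric_space\<close> demands
  nonnegativity and symmetry on the whole type.\<close>

definition hdist :: "'a \<Rightarrow> 'a \<Rightarrow> real" where
  "hdist x y = (if x \<in> carrier H \<and> y \<in> carrier H then hnorm (x \<ominus> y) else 0)"

lemma real_scalar: "complex_of_real r \<in> K"
  using scalars by auto

lemma minus_eq_smult: "x \<in> carrier H \<Longrightarrow> \<ominus> x = (-1) \<odot> x"
proof -
  assume x: "x \<in> carrier H"
  have K: "(-1) \<in> K" "1 \<in> K" using scalars by auto
  have "(-1) \<odot> x \<oplus> 1 \<odot> x = ((-1) \<oplus>\<^bsub>scalar_field K\<^esub> 1) \<odot> x"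
    using smult_l_distr[of "-1" 1 x] K x by (simp add: scalar_field_def)
  also have "\<dots> = \<zero>"
    using smult_l_null[OF x] by (simp add: scalar_field_def)
  finally have "(-1) \<odot> x \<oplus> x = \<zero>"
    using smult_one[OF x] by (simp add: scalar_field_def)
  moreover have "(-1) \<odot> x \<in> carrier H"
    using smult_closed[of "-1" x] K x by (simp add: scalar_field_def)
  ultimately show ?thesis
    using x M.minus_equality by blast
qed

lemma smult_in: "\<lbrakk>a \<in> K; x \<in> carrier H\<rbrakk> \<Longrightarrow> a \<odot> x \<in> carrier H"
  using smult_closed[of a x] by (simp add: scalar_field_def)

lemma ip_diff_left:
  assumes "x \<in> carrier H" "y \<in> carrier H" "z \<in> carrier H"
  shows "ip (x \<ominus> y) z = ip x z - ip y z"
proof -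
  have "(-1) \<in> K" using scalars by auto
  then show ?thesis
    using assms by (simp add: a_minus_def minus_eq_smult ip_add_left ip_smult_left smult_in)
qed

lemma ip_add_right:
  assumes "x \<in> carrier H" "y \<in> carrier H" "z \<in> carrier H"
  shows "ip z (x \<oplus> y) = ip z x + ip z y"
  using assms ip_commute[of z "x \<oplus> y"] ip_commute[of z x] ip_commute[of z y]
  by (simp add: ip_add_left)

lemma ip_diff_right:
  assumes "x \<in> carrier H" "y \<in> carrier H" "z \<in> carrier H"
  shows "ip z (x \<ominus> y) = ip z x - ip z y"
  using assms ip_commute[of z "x \<ominus> y"] ip_commute[of z x] ip_commute[of z y]
  by (simp add: ip_diff_left)

lemma ip_smult_right:
  assumes "a \<in> K" "x \<in> carrier H" "y \<in> carrier H"
  shows "ip x (a \<odot> y) = cnj a * ip x y"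
  using assms ip_commute[of x "a \<odot> y"] ip_commute[of x y]
  by (simp add: ip_smult_left smult_in)

lemma ip_zero_zero: "ip \<zero> \<zero> = 0"
  using ip_add_left[of \<zero> \<zero> \<zero>] by simp

lemma Re_ip_nonneg: "x \<in> carrier H \<Longrightarrow> 0 \<le> Re (ip x x)"
  using ip_pos[of x] ip_zero_zero by (cases "x = \<zero>") auto

lemma Re_ip_eq_0: "x \<in> carrier H \<Longrightarrow> Re (ip x x) = 0 \<longleftrightarrow> x = \<zero>"
  using ip_pos[of x] ip_zero_zero by (cases "x = \<zero>") auto

lemma Re_ip_commute: "\<lbrakk>x \<in> carrier H; y \<in> carrier H\<rbrakk> \<Longrightarrow> Re (ip x y) = Re (ip y x)"
  using ip_commute[of x y] by (simp add: complex_eq_iff)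

lemma Re_Cauchy_Schwarz:
  assumes x: "x \<in> carrier H" and y: "y \<in> carrier H"
  shows "\<bar>Re (ip x y)\<bar> \<le> hnorm x * hnorm y"
proof -
  define A B C where "A = Re (ip x x)" and "B = Re (ip x y)" and "C = Re (ip y y)"
  have q: "0 \<le> s\<^sup>2 * A + 2 * s * t * B + t\<^sup>2 * C" for s t :: real
  proof -
    let ?u = "complex_of_real s \<odot> x" and ?v = "complex_of_real t \<odot> y"
    have uv: "?u \<in> carrier H" "?v \<in> carrier H"
      using smult_in[OF real_scalar] x y by auto
    have "0 \<le> Re (ip (?u \<oplus> ?v) (?u \<oplus> ?v))"
      using uv Re_ip_nonneg by simp
    also have "\<dots> = s\<^sup>2 * A + 2 * s * t * B + t\<^sup>2 * C"
      using uv x y Re_ip_commute[OF x y]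
      by (simp add: ip_add_left ip_add_right ip_smult_left ip_smult_right real_scalar
          A_def B_def C_def power2_eq_square algebra_simps)
    finally show ?thesis .
  qed
  have AC: "0 \<le> A" "0 \<le> C" using Re_ip_nonneg x y by (auto simp: A_def C_def)
  have "B\<^sup>2 \<le> A * C"
  proof (cases "C = 0")
    case True
    have "B = 0"
    proof (rule ccontr)
      assume "B \<noteq> 0"
      moreover have "0 \<le> A + 2 * (- (A + 1) / (2 * B)) * B"
        using q[of 1 "- (A + 1) / (2 * B)"] True by simp
      ultimately show False by (simp add: field_simps)
    qed
    then show ?thesis using AC by simp
  next
    case False
    then have "0 < C" using AC by simp
    have "0 \<le> C * (A * C - B\<^sup>2)"
      using q[of C "- B"] by (simp add: power2_eq_square algebra_simps)
    then show ?thesis using \<open>0 < C\<close> by (simp add: zero_le_mult_iff)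
  qed
  then have "sqrt (B\<^sup>2) \<le> sqrt (A * C)" by (rule real_sqrt_le_mono)
  then show ?thesis by (simp add: real_sqrt_mult hnorm_def A_def B_def C_def)
qed

lemma hnorm_sq: "x \<in> carrier H \<Longrightarrow> (hnorm x)\<^sup>2 = Re (ip x x)"
  by (simp add: hnorm_def Re_ip_nonneg)

lemma hnorm_nonneg: "x \<in> carrier H \<Longrightarrow> 0 \<le> hnorm x"
  by (simp add: hnorm_def Re_ip_nonneg)

lemma hnorm_triangle:
  assumes x: "x \<in> carrier H" and y: "y \<in> carrier H"
  shows "hnorm (x \<oplus> y) \<le> hnorm x + hnorm y"
proof (rule power2_le_imp_le)
  have "(hnorm (x \<oplus> y))\<^sup>2 = (hnorm x)\<^sup>2 + (hnorm y)\<^sup>2 + 2 * Re (ip x y)"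
    using x y Re_ip_commute[OF x y] by (simp add: hnorm_sq ip_add_left ip_add_right)
  also have "\<dots> \<le> (hnorm x + hnorm y)\<^sup>2"
    using Re_Cauchy_Schwarz[OF x y] by (simp add: power2_sum)
  finally show "(hnorm (x \<oplus> y))\<^sup>2 \<le> (hnorm x + hnorm y)\<^sup>2" .
  show "0 \<le> hnorm x + hnorm y" using hnorm_nonneg x y by simp
qed

sublocale Metric_space "carrier H" hdist
proof
  show "0 \<le> hdist x y" for x y
    by (simp add: hdist_def hnorm_nonneg)
  show "hdist x y = hdist y x" for x y
    by (auto simp: hdist_def hnorm_def ip_diff_left ip_diff_right algebra_simps)
  show "hdist x y = 0 \<longleftrightarrow> x = y" if "x \<in> carrier H" "y \<in> carrier H" for x y
  proof -
    have "x \<ominus> y = \<zero> \<longleftrightarrow> x = y"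
      using that M.minus_equality[of x "\<ominus> y"] by (auto simp: a_minus_def M.r_neg)
    then show ?thesis
      using that by (simp add: hdist_def hnorm_def Re_ip_eq_0)
  qed
  show "hdist x z \<le> hdist x y + hdist y z"
    if "x \<in> carrier H" "y \<in> carrier H" "z \<in> carrier H" for x y z
  proof -
    have "x \<ominus> z = (x \<ominus> y) \<oplus> (y \<ominus> z)"
      using that by (simp add: a_minus_def M.a_assoc M.r_neg1 M.r_neg2)
    then show ?thesis
      using that hnorm_triangle[of "x \<ominus> y" "y \<ominus> z"] by (simp add: hdist_def)
  qed
qed

definition lin_span :: "'a set \<Rightarrow> 'a set" where
  "lin_span D = {\<Oplus>g\<in>S. c g \<odot> g | S c. finite S \<and> S \<subseteq> D \<and> (\<forall>g\<in>S. c g \<in> K)}"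

definition dictionary :: "'a set \<Rightarrow> bool" where
  "dictionary D \<longleftrightarrow> D \<subseteq> {g \<in> carrier H. hnorm g = 1} \<and>
     Abstract_Topology.closure_of mtopology (lin_span D) = carrier H"

text \<open>Chosen elements are indexed from 1, so \<open>\<phi> 0\<close> and \<open>t 0\<close> are never used.\<close>

primrec residual :: "'a \<Rightarrow> (nat \<Rightarrow> 'a) \<Rightarrow> nat \<Rightarrow> 'a" where
  "residual f \<phi> 0 = f"
| "residual f \<phi> (Suc n) =
     residual f \<phi> n \<ominus> (ip (residual f \<phi> n) (\<phi> (Suc n)) \<odot> \<phi> (Suc n))"

definition approximant :: "'a \<Rightarrow> (nat \<Rightarrow> 'a) \<Rightarrow> nat \<Rightarrow> 'a" where
  "approximant f \<phi> n = (\<Oplus>j\<in>{1..n}. ip (residual f \<phi> (j - 1)) (\<phi> j) \<odot> \<phi> j)"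

definition weak_greedy_choice :: "(nat \<Rightarrow> real) \<Rightarrow> 'a set \<Rightarrow> 'a \<Rightarrow> (nat \<Rightarrow> 'a) \<Rightarrow> bool" where
  "weak_greedy_choice t D f \<phi> \<longleftrightarrow> (\<forall>n\<ge>1. \<phi> n \<in> D \<and>
     cmod (ip (residual f \<phi> (n - 1)) (\<phi> n))
       \<ge> t n * (SUP g\<in>D. cmod (ip (residual f \<phi> (n - 1)) g)))"

end

locale hilbert_space = inner_product_space +
  assumes complete: mcomplete
begin

definition wga_converges_in :: "(nat \<Rightarrow> real) \<Rightarrow> bool" where
  "wga_converges_in t \<longleftrightarrow>
     (\<forall>D f \<phi>. dictionary D \<and> f \<in> carrier H \<and> weak_greedy_choice t D f \<phi> \<longrightarrow>
        limitin mtopology (approximant f \<phi>) f sequentially)"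

end

text \<open>The first argument only carries the type \<open>'a\<close>, which serves as the universe
  containing the carriers of the Hilbert spaces.  A Hilbert space other than the zero space has at
  least continuum many points, so this is meaningful only if \<open>'a\<close> is at least that large.\<close>

definition wga_converges :: "'a itself \<Rightarrow> complex set \<Rightarrow> (nat \<Rightarrow> real) \<Rightarrow> bool" where
  "wga_converges U K t \<longleftrightarrow>
     (\<forall>(H :: (complex, 'a) module) ip.
        hilbert_space K H ip \<longrightarrow> hilbert_space.wga_converges_in K H ip t)"

end

theory Submission
  imports Defs
begin

text \<open>
  The easiest series to work with is the one over dyadic blocks: its \<open>n\<close>-th term is the root mean square
  \<open>block_rms t n\<close> of \<open>t\<close> over \<open>2 ^ n \<le> k < 2 ^ (n + 1)\<close>. The other two series compare with it
  through \<open>sqrt A\<^sub>n - sqrt A\<^sub>n\<^sub>-\<^sub>1\<close>, where \<open>A\<^sub>n\<close> is the sum of the first \<open>n\<close> squares: this difference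
  is between one half of \<open>t\<^sub>n\<^sup>2 / sqrt A\<^sub>n\<close> and all of it, and it telescopes over a block
  (\<open>summable_weighted_increment_iff\<close>, \<open>summable_energy_weighted_iff\<close>).

  Divergence implies convergence of the algorithm. Write \<open>a\<^sub>n\<close> for the modulus of the \<open>n\<close>-th coefficient;
  the sum of the \<open>a\<^sub>n\<^sup>2\<close> is finite because each step is an orthogonal projection. If
  \<open>\<delta> t\<^sub>n \<le> a\<^sub>n (1 + a\<^sub>1 + \<dots> + a\<^sub>n)\<close> held for all large \<open>n\<close>, a discrete Hardy inequality would make the
  block series converge (\<open>summable_block_rms_if_dominated\<close>). So along infinitely many \<open>n\<close> the product
  \<open>(a\<^sub>n / t\<^sub>n) (1 + a\<^sub>1 + \<dots> + a\<^sub>n)\<close> is as small as desired. Since \<open>a\<^sub>n / t\<^sub>n\<close> bounds all inner products of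
  the residual with the dictionary, and the difference of two residuals is a combination of dictionary
  elements with coefficients \<open>a\<^sub>j\<close>, the residuals form a Cauchy sequence, and their limit is orthogonal to
  the dictionary, hence zero (\<open>wga_residual_tends_to_zero\<close>).

  Summability produces a counterexample. The residual is the sum of two orthogonal parts. The first is
  \<open>height n\<close> times the vector \<open>ramp (width n)\<close>, whose coordinates are 1 up to the real
  number \<open>width n\<close>, with the last one fractional. As the width grows this vector spreads over more and more
  coordinates, so every dictionary element sees it only with size about \<open>height n\<close>, that is, about
  \<open>1 / sqrt (width n)\<close>; and when the front advances by \<open>s\<^sub>n\<close>, only a fraction of order \<open>s\<^sub>n\<^sup>2 / width\<close>
  of the squared norm is lost. The second part is a stock of fresh orthonormal directions, one for each step,
  with coefficients \<open>8 t\<^sub>n height (n - 1)\<close>. Step \<open>n\<close> advances the front a little and removes the \<open>n\<close>-th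
  fresh direction; this removal alone makes the step large enough for weakness \<open>t\<^sub>n\<close>, however short the
  advance is. Altogether the run exists, with norms bounded away from zero, as soon as the sums of
  \<open>s\<^sub>n\<^sup>2 / width\<close> and \<open>t\<^sub>n\<^sup>2 / width\<close> are finite and the front rests whenever \<open>t\<^sub>n > 1 / 2\<close>, and a schedule \<open>s\<close> achieving this can be read off
  from the block series (\<open>spreading_schedule_exists\<close>, \<open>not_convergent\<close>).
\<close>

section \<open>Equivalence of the three series\<close>

definition dyadic_block :: "nat \<Rightarrow> nat set" where
  "dyadic_block n = {2 ^ n..2 ^ (n + 1) - 1}"

lemma dyadic_block_eq: "dyadic_block n = {2 ^ n..<2 ^ Suc n}"
  unfolding dyadic_block_def by (auto simp: less_eq_Suc_le[symmetric]) (metis Suc_pred less_Suc_eq_le mult_pos_pos pos2 zero_less_power)+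

lemma finite_dyadic_block [simp]: "finite (dyadic_block n)"
  by (simp add: dyadic_block_def)

lemma card_dyadic_block [simp]: "card (dyadic_block n) = 2 ^ n"
  by (simp add: dyadic_block_eq)

lemma sum_up_to_power_of_2:
  fixes a :: "nat \<Rightarrow> real"
  shows "sum a {1..<2 ^ n} = (\<Sum>i<n. sum a (dyadic_block i))"
proof (induction n)
  case (Suc n)
  have "sum a {1..<2 ^ Suc n} = sum a {1..<2 ^ n} + sum a {2 ^ n..<2 ^ Suc n}"
    by (rule sum.atLeastLessThan_concat[symmetric]) auto
  then show ?case using Suc by (simp add: dyadic_block_eq)
qed simp

lemma summable_nonneg_bounded:
  fixes a :: "nat \<Rightarrow> real"
  assumes "\<And>n. 0 \<le> a n" "\<And>n. sum a {..<n} \<le> C"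
  shows "summable a"
  using assms by (intro summableI_nonneg_bounded) auto

lemma summable_iff_dyadic_block_sums:
  fixes a :: "nat \<Rightarrow> real"
  assumes nonneg: "\<And>k. 1 \<le> k \<Longrightarrow> 0 \<le> a k"
  shows "summable (\<lambda>m. a (m + 1)) \<longleftrightarrow> summable (\<lambda>n. sum a (dyadic_block n))"
proof
  have shift: "(\<Sum>m<n. a (m + 1)) = sum a {1..<Suc n}" for n
    using sum.atLeast1_atMost_eq[of a n] by (simp add: atLeastLessThanSuc_atLeastAtMost)
  have block_pos: "k \<ge> 1" if "k \<in> dyadic_block n" for k n
    using that by (auto simp: dyadic_block_def) (metis Suc_leI le_trans pos2 zero_less_power)
  have block_nonneg: "0 \<le> sum a (dyadic_block n)" for n
    using block_pos nonneg by (intro sum_nonneg) auto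
  {
    assume sm: "summable (\<lambda>m. a (m + 1))"
    show "summable (\<lambda>n. sum a (dyadic_block n))"
    proof (rule summable_nonneg_bounded)
      show "(\<Sum>i<n. sum a (dyadic_block i)) \<le> (\<Sum>m. a (m + 1))" for n
      proof -
        have "(\<Sum>i<n. sum a (dyadic_block i)) = sum a {1..<Suc (2 ^ n - 1)}"
          by (simp add: sum_up_to_power_of_2[symmetric])
        also have "\<dots> = (\<Sum>m<2 ^ n - 1. a (m + 1))" by (simp only: shift)
        also have "\<dots> \<le> (\<Sum>m. a (m + 1))"
          using nonneg by (intro sum_le_suminf sm) auto
        finally show ?thesis .
      qed
    qed (rule block_nonneg)
  next
    assume sm: "summable (\<lambda>n. sum a (dyadic_block n))"
    show "summable (\<lambda>m. a (m + 1))"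
    proof (rule summable_nonneg_bounded)
      show "(\<Sum>m<n. a (m + 1)) \<le> (\<Sum>n. sum a (dyadic_block n))" for n
      proof -
        have "(\<Sum>m<n. a (m + 1)) = sum a {1..<Suc n}" by (rule shift)
        also have "\<dots> \<le> sum a {1..<2 ^ n}"
        proof (intro sum_mono2)
          show "{1..<Suc n} \<subseteq> {1..<2 ^ n}"
            using Suc_leI[OF less_exp[of n]] by (intro ivl_subset[THEN iffD2]) simp
        qed (use nonneg in auto)
        also have "\<dots> = (\<Sum>i<n. sum a (dyadic_block i))" by (rule sum_up_to_power_of_2)
        also have "\<dots> \<le> (\<Sum>n. sum a (dyadic_block n))"
          using block_nonneg by (intro sum_le_suminf sm) auto
        finally show ?thesis .
      qed
    qed (use nonneg in auto)
  }
qed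

text \<open>Summing the recursion gives \<open>(1 - \<theta>) \<Sum>z \<le> z 0 + \<Sum>y\<close>. This
  replaces an exchange of two summations whenever \<open>z\<close> is a geometrically weighted moving sum of
  \<open>y\<close>.\<close>

lemma summable_contractive_recursion:
  fixes z y :: "nat \<Rightarrow> real"
  assumes z: "\<And>n. 0 \<le> z n" and y: "\<And>n. 0 \<le> y n" and sm: "summable y"
    and \<theta>: "0 \<le> \<theta>" "\<theta> < 1" and rec: "\<And>n. z (Suc n) \<le> y n + \<theta> * z n"
  shows "summable z"
proof (rule summable_nonneg_bounded)
  fix n
  have "sum z {..<n} \<le> sum z {..<Suc n}" using z by simp
  also have "\<dots> = z 0 + (\<Sum>i<n. z (Suc i))" by (rule sum.lessThan_Suc_shift)
  also have "(\<Sum>i<n. z (Suc i)) \<le> (\<Sum>i<n. y i + \<theta> * z i)" by (intro sum_mono rec)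
  also have "\<dots> = sum y {..<n} + \<theta> * sum z {..<n}" by (simp add: sum.distrib sum_distrib_left)
  also have "sum y {..<n} \<le> suminf y" using y by (intro sum_le_suminf sm) auto
  finally have "(1 - \<theta>) * sum z {..<n} \<le> z 0 + suminf y" by (simp add: algebra_simps)
  then show "sum z {..<n} \<le> (z 0 + suminf y) / (1 - \<theta>)"
    using \<theta> by (simp add: field_simps)
qed (rule z)

context
  fixes t :: "nat \<Rightarrow> real"
begin

definition energy where "energy n = (\<Sum>k = 1..n. (t k)\<^sup>2)"
definition block_rms where "block_rms n = sqrt ((1 / 2 ^ n) * (\<Sum>k\<in>dyadic_block n. (t k)\<^sup>2))"

lemma energy_nonneg: "0 \<le> energy n" by (simp add: energy_def sum_nonneg)
lemma energy_Suc: "energy (Suc n) = energy n + (t (Suc n))\<^sup>2" by (simp add: energy_def)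
lemma energy_mono: "m \<le> n \<Longrightarrow> energy m \<le> energy n"
  unfolding energy_def by (intro sum_mono2) auto

lemma energy_block: "energy (2 ^ Suc n - 1) = energy (2 ^ n - 1) + (\<Sum>k\<in>dyadic_block n. (t k)\<^sup>2)"
proof -
  have "{1..2 ^ m - 1} = {1..<2 ^ m :: nat}" for m
    by (metis atLeastLessThanSuc_atLeastAtMost Suc_pred' pos2 zero_less_power)
  then show ?thesis unfolding energy_def
    by (simp only: sum_up_to_power_of_2 sum.lessThan_Suc)
qed

lemma block_rms_nonneg: "0 \<le> block_rms n" by (simp add: block_rms_def sum_nonneg)

lemma block_rms_le_energy: "block_rms n \<le> sqrt (energy (2 ^ Suc n - 1)) / sqrt (2 ^ n)"
proof -
  have "(\<Sum>k\<in>dyadic_block n. (t k)\<^sup>2) \<le> energy (2 ^ Suc n - 1)"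
    using energy_nonneg by (simp only: energy_block) simp
  then show ?thesis
    by (simp add: block_rms_def real_sqrt_divide[symmetric] divide_right_mono)
qed

definition weighted_increment where
  "weighted_increment n = 1 / sqrt (real n) * (sqrt (energy n) - sqrt (energy (n - 1)))"

lemma weighted_increment_nonneg: "0 \<le> weighted_increment n"
  unfolding weighted_increment_def by (simp add: energy_mono)

text \<open>This makes the square roots of the energies preferable to the squares \<open>t k ^ 2\<close>
  themselves: one block contributes only a difference of two terms.\<close>

lemma sum_block_telescope:
  "(\<Sum>k\<in>dyadic_block n. sqrt (energy k) - sqrt (energy (k - 1))) = sqrt (energy (2 ^ Suc n - 1)) - sqrt (energy (2 ^ n - 1))"
proof -
  have "(\<Sum>k\<in>{m..<m + j}. sqrt (energy k) - sqrt (energy (k - 1))) = sqrt (energy (m + j - 1)) - sqrt (energy (m - 1))" for m j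
    by (induction j) auto
  from this[of "2 ^ n" "2 ^ n"] show ?thesis by (simp add: dyadic_block_eq mult_2)
qed

text \<open>Over a block the factor \<open>1 / sqrt k\<close> is constant up to \<open>sqrt 2\<close>, so
  the increments there add up to about \<open>\<delta> n / sqrt (2 ^ n)\<close> with \<open>\<delta>
  n\<close> the telescoped difference. Subadditivity of the square root gives \<open>\<delta> n / sqrt (2 ^
  n) \<le> block_rms n\<close>. The reverse inequality fails block by block, but \<open>\<sigma> n = sqrt
  (energy) / sqrt (2 ^ n)\<close>, with the energy at the end of block \<open>n\<close>, dominates
  \<open>block_rms n\<close> and is a geometrically weighted sum of the terms up to \<open>n\<close>, that
  is, of \<open>\<delta> i / sqrt (2 ^ i)\<close>.\<close>

lemma summable_weighted_increment_iff: "summable (\<lambda>m. weighted_increment (m + 1)) \<longleftrightarrow> summable block_rms"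
proof -
  define \<sigma> where "\<sigma> n = sqrt (energy (2 ^ Suc n - 1)) / sqrt (2 ^ n)" for n
  define \<delta> where "\<delta> n = sqrt (energy (2 ^ Suc n - 1)) - sqrt (energy (2 ^ n - 1))" for n
  have "2 ^ n \<le> 2 ^ Suc n - (1::nat)" for n by (induction n) auto
  then have \<delta>: "0 \<le> \<delta> n" for n
    unfolding \<delta>_def using energy_mono[of "2 ^ n - 1" "2 ^ Suc n - 1"] by simp
  have pos: "0 \<le> sqrt (energy k) - sqrt (energy (k - 1))" for k by (simp add: energy_mono)
  have lo: "\<delta> n / sqrt (2 ^ Suc n) \<le> sum weighted_increment (dyadic_block n)" for n
  proof -
    have "\<delta> n / sqrt (2 ^ Suc n) = (\<Sum>k\<in>dyadic_block n. 1 / sqrt (2 ^ Suc n) * (sqrt (energy k) - sqrt (energy (k - 1))))"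
      by (simp only: \<delta>_def sum_distrib_left[symmetric] sum_block_telescope) simp
    also have "\<dots> \<le> sum weighted_increment (dyadic_block n)"
    proof (intro sum_mono)
      fix k assume "k \<in> dyadic_block n"
      then have k: "2 ^ n \<le> k" "k \<le> 2 ^ Suc n" by (auto simp: dyadic_block_eq)
      have "real k \<le> 2 ^ Suc n" using k(2) by (metis of_nat_le_iff of_nat_numeral of_nat_power)
      moreover have "0 < k" using k(1) by (metis gr0I power_not_zero zero_neq_numeral le_zero_eq)
      ultimately show "1 / sqrt (2 ^ Suc n) * (sqrt (energy k) - sqrt (energy (k - 1))) \<le> weighted_increment k"
        unfolding weighted_increment_def using pos by (intro mult_right_mono divide_left_mono) auto
    qed
    finally show ?thesis .
  qed
  have hi: "sum weighted_increment (dyadic_block n) \<le> block_rms n" for n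
  proof -
    have "sum weighted_increment (dyadic_block n) \<le> (\<Sum>k\<in>dyadic_block n. 1 / sqrt (2 ^ n) * (sqrt (energy k) - sqrt (energy (k - 1))))"
    proof (intro sum_mono)
      fix k assume "k \<in> dyadic_block n"
      then have k: "2 ^ n \<le> k" by (auto simp: dyadic_block_eq)
      have "2 ^ n \<le> real k" using k by (metis of_nat_le_iff of_nat_numeral of_nat_power)
      moreover have "0 < k" using k(1) by (metis gr0I power_not_zero zero_neq_numeral le_zero_eq)
      ultimately show "weighted_increment k \<le> 1 / sqrt (2 ^ n) * (sqrt (energy k) - sqrt (energy (k - 1)))"
        unfolding weighted_increment_def using pos by (intro mult_right_mono divide_left_mono) auto
    qed
    also have "\<dots> = \<delta> n / sqrt (2 ^ n)"
      by (simp only: \<delta>_def sum_distrib_left[symmetric] sum_block_telescope) simp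
    also have "\<dots> \<le> sqrt (\<Sum>k\<in>dyadic_block n. (t k)\<^sup>2) / sqrt (2 ^ n)"
    proof (intro divide_right_mono)
      show "\<delta> n \<le> sqrt (\<Sum>k\<in>dyadic_block n. (t k)\<^sup>2)"
        unfolding \<delta>_def energy_block
        using sqrt_add_le_add_sqrt[of "energy (2 ^ n - 1)" "\<Sum>k\<in>dyadic_block n. (t k)\<^sup>2"] energy_nonneg
        by (simp add: sum_nonneg)
    qed simp
    finally show ?thesis by (simp add: block_rms_def real_sqrt_divide)
  qed
  have blocks: "summable (\<lambda>m. weighted_increment (m + 1)) \<longleftrightarrow> summable (\<lambda>n. sum weighted_increment (dyadic_block n))"
    by (rule summable_iff_dyadic_block_sums) (rule weighted_increment_nonneg)
  show ?thesis
  proof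
    assume "summable block_rms"
    then show "summable (\<lambda>m. weighted_increment (m + 1))"
      unfolding blocks by (rule summable_comparison_test'[where N = 0])
        (use hi in \<open>auto simp: weighted_increment_nonneg sum_nonneg\<close>)
  next
    assume "summable (\<lambda>m. weighted_increment (m + 1))"
    then have sm: "summable (\<lambda>n. sum weighted_increment (dyadic_block n))" by (simp only: blocks)
    have sm\<delta>: "summable (\<lambda>n. \<delta> n / sqrt (2 ^ n))"
    proof (rule summable_comparison_test'[OF summable_mult[OF sm, of "sqrt 2"], where N = 0])
      show "norm (\<delta> n / sqrt (2 ^ n)) \<le> sqrt 2 * sum weighted_increment (dyadic_block n)" for n
        using lo[of n] \<delta>[of n] by (simp add: real_sqrt_mult field_simps)
    qed
    have "summable \<sigma>"
    proof (rule summable_contractive_recursion)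
      show "0 \<le> \<sigma> n" for n by (simp add: \<sigma>_def energy_nonneg)
      show "summable (\<lambda>n. \<delta> (Suc n) / sqrt (2 ^ Suc n))" using sm\<delta> by (subst summable_Suc_iff)
      show "\<sigma> (Suc n) \<le> \<delta> (Suc n) / sqrt (2 ^ Suc n) + 1 / sqrt 2 * \<sigma> n" for n
        by (simp add: \<sigma>_def \<delta>_def real_sqrt_mult diff_divide_distrib)
      show "0 \<le> \<delta> (Suc n) / sqrt (2 ^ Suc n)" for n using \<delta> by simp
    qed auto
    then show "summable block_rms"
      by (rule summable_comparison_test'[where N = 0])
        (use block_rms_nonneg block_rms_le_energy in \<open>simp add: \<sigma>_def\<close>)
  qed
qed

text \<open>Rationalising \<open>sqrt (energy n) - sqrt (energy (n - 1))\<close> turns the increment into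
  \<open>t n ^ 2\<close> over \<open>sqrt n (sqrt (energy n) + sqrt (energy (n - 1)))\<close>; once \<open>n
  energy n \<ge> 1\<close> this denominator agrees with \<open>sqrt (1 + n energy n)\<close> up to a factor
  2.\<close>

lemma summable_energy_weighted_iff:
  "summable (\<lambda>m. (1 + real (m + 1) * energy (m + 1)) powr (- 1 / 2) * (t (m + 1))\<^sup>2)
    \<longleftrightarrow> summable (\<lambda>m. weighted_increment (m + 1))"
proof (cases "\<exists>n. energy n > 0")
  case False
  then have e: "energy n = 0" for n using energy_nonneg[of n] False by (meson not_less order_antisym)
  moreover have "t (m + 1) = 0" for m using energy_Suc[of m] e by simp
  ultimately show ?thesis by (simp add: weighted_increment_def)
next
  case True
  then obtain n0 where n0: "energy n0 > 0" by blast
  define w where "w n = (1 + real n * energy n) powr (- 1 / 2) * (t n)\<^sup>2" for n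
  have w_eq: "w n = (t n)\<^sup>2 / sqrt (1 + real n * energy n)" for n
  proof -
    have "0 \<le> 1 + real n * energy n" using energy_nonneg[of n] by simp
    then have "(1 + real n * energy n) powr (- (1 / 2)) = 1 / sqrt (1 + real n * energy n)"
      by (simp add: powr_minus powr_half_sqrt divide_inverse[symmetric] del: inverse_eq_divide)
        (simp add: powr_half_sqrt inverse_eq_divide)
    then show ?thesis by (simp add: w_def)
  qed
  have w_nonneg: "0 \<le> w n" for n by (simp add: w_def)
  have weighted_increment_eq: "weighted_increment n = (t n)\<^sup>2 / (sqrt (real n) * (sqrt (energy n) + sqrt (energy (n - 1))))"
    if "1 \<le> n" "0 < energy n" for n
  proof -
    have e: "energy n = energy (n - 1) + (t n)\<^sup>2" using energy_Suc[of "n - 1"] that by simp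
    have "0 < sqrt (energy n) + sqrt (energy (n - 1))"
      using that energy_nonneg[of "n - 1"] by (simp add: add_pos_nonneg)
    moreover have "(sqrt (energy n) - sqrt (energy (n - 1))) * (sqrt (energy n) + sqrt (energy (n - 1))) = (t n)\<^sup>2"
      using energy_nonneg[of n] energy_nonneg[of "n - 1"] e by (simp add: algebra_simps)
    ultimately have "sqrt (energy n) - sqrt (energy (n - 1)) = (t n)\<^sup>2 / (sqrt (energy n) + sqrt (energy (n - 1)))"
      by (simp add: field_simps)
    then show ?thesis by (simp add: weighted_increment_def)
  qed
  have ev: "0 < energy n" if "n \<ge> n0" for n using n0 energy_mono[OF that] by simp
  have low: "w n \<le> 2 * weighted_increment n" if "1 \<le> n" "n0 \<le> n" for n
  proof -
    have "sqrt (energy (n - 1)) \<le> sqrt (energy n)" by (simp add: energy_mono)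
    then have "sqrt (real n) * (sqrt (energy n) + sqrt (energy (n - 1))) \<le> 2 * sqrt (real n * energy n)"
      by (simp add: real_sqrt_mult algebra_simps mult_left_mono)
    also have "\<dots> \<le> 2 * sqrt (1 + real n * energy n)" by simp
    finally have "sqrt (real n) * (sqrt (energy n) + sqrt (energy (n - 1))) \<le> 2 * sqrt (1 + real n * energy n)" .
    moreover have "0 < sqrt (real n) * (sqrt (energy n) + sqrt (energy (n - 1)))"
      using ev[OF that(2)] that energy_nonneg[of "n - 1"] by (simp add: add_pos_nonneg)
    moreover have "0 < 2 * sqrt (1 + real n * energy n)"
      using energy_nonneg[of n] by (simp add: add_pos_nonneg)
    ultimately have "(t n)\<^sup>2 / (2 * sqrt (1 + real n * energy n)) \<le> weighted_increment n"
      unfolding weighted_increment_eq[OF that(1) ev[OF that(2)]]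
      by (intro divide_left_mono mult_pos_pos[of "2 * sqrt _"]) simp_all
    then show ?thesis by (simp add: w_eq)
  qed
  obtain n1 :: nat where n1: "n1 * energy n0 \<ge> 1" "1 \<le> n1"
  proof -
    obtain k :: nat where "1 / energy n0 < k" using reals_Archimedean2 by blast
    then have "1 \<le> real k * energy n0" using n0 by (simp add: field_simps)
    moreover from this have "1 \<le> k" by (cases k) auto
    ultimately show ?thesis using that by blast
  qed
  have up: "weighted_increment n \<le> 2 * w n" if "n1 \<le> n" "n0 \<le> n" for n
  proof -
    have "1 \<le> real n1 * energy n0" by fact
    also have "\<dots> \<le> real n * energy n" using that n0 energy_mono by (intro mult_mono) auto
    finally have *: "1 \<le> real n * energy n" .
    have pos: "0 < sqrt (real n) * (sqrt (energy n) + sqrt (energy (n - 1)))"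
      using ev[OF that(2)] that n1(2) energy_nonneg[of "n - 1"] by (simp add: add_pos_nonneg)
    have "sqrt (1 + real n * energy n) \<le> sqrt (2\<^sup>2 * (real n * energy n))" using * by (intro real_sqrt_le_mono) simp
    also have "\<dots> = 2 * (sqrt (real n) * sqrt (energy n))" by (simp add: real_sqrt_mult)
    also have "\<dots> \<le> 2 * (sqrt (real n) * (sqrt (energy n) + sqrt (energy (n - 1))))"
      using energy_nonneg by (intro mult_left_mono) auto
    finally have le: "sqrt (1 + real n * energy n) \<le> 2 * (sqrt (real n) * (sqrt (energy n) + sqrt (energy (n - 1))))" .
    have "0 < sqrt (1 + real n * energy n)" using * by simp
    with pos have "0 < 2 * (sqrt (real n) * (sqrt (energy n) + sqrt (energy (n - 1)))) * sqrt (1 + real n * energy n)"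
      by (intro mult_pos_pos[of "2 * _"]) linarith+
    then have "(t n)\<^sup>2 / (2 * (sqrt (real n) * (sqrt (energy n) + sqrt (energy (n - 1))))) \<le> (t n)\<^sup>2 / sqrt (1 + real n * energy n)"
      by (intro divide_left_mono[OF le]) auto
    moreover have "weighted_increment n = 2 * ((t n)\<^sup>2 / (2 * (sqrt (real n) * (sqrt (energy n) + sqrt (energy (n - 1))))))"
      using weighted_increment_eq[of n] ev[OF that(2)] n1(2) that(1) by simp
    ultimately show ?thesis unfolding w_eq by linarith
  qed
  have "summable (\<lambda>m. w (m + 1))" if "summable (\<lambda>m. weighted_increment (m + 1))"
    by (rule summable_comparison_test'[OF summable_mult[OF that, of 2], where N = n0])
      (use low w_nonneg in simp)
  moreover have "summable (\<lambda>m. weighted_increment (m + 1))" if "summable (\<lambda>m. w (m + 1))"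
    by (rule summable_comparison_test'[OF summable_mult[OF that, of 2], where N = "max n0 n1"])
      (use up weighted_increment_nonneg in simp)
  ultimately show ?thesis by (auto simp: w_def)
qed

lemma block_rms_sq: "(\<Sum>k\<in>dyadic_block n. (t k)\<^sup>2) = 2 ^ n * (block_rms n)\<^sup>2"
  by (simp add: block_rms_def sum_nonneg)

end

section \<open>A dyadic Hardy inequality for greedy coefficients\<close>

context
  fixes t :: "nat \<Rightarrow> real"
  assumes t: "\<And>j. j \<ge> 1 \<Longrightarrow> 0 \<le> t j \<and> t j \<le> 1"
begin

text \<open>With \<open>W\<close> bounding \<open>1 + a\<^sub>1 + \<dots> + a\<^sub>k\<close> throughout
  block \<open>n\<close> and \<open>\<beta> n\<close> the Euclidean norm of \<open>a\<close> on the block,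
  domination gives \<open>\<delta> block_rms n \<le> \<beta> n Z n\<close> for \<open>Z n = W n / sqrt (2 ^
  n)\<close>. The sequence \<open>\<beta>\<close> is square summable by assumption; \<open>Z\<close> is
  square summable because Cauchy-Schwarz on a block gives \<open>Z (n + 1) \<le> \<beta> (n + 1) + Z n /
  sqrt 2\<close>. This is Hardy's inequality in dyadic form.\<close>

lemma summable_block_rms_if_dominated:
  fixes a :: "nat \<Rightarrow> real"
  assumes a: "\<And>k. 0 \<le> a k" and sm: "summable (\<lambda>m. (a (m + 1))\<^sup>2)" and \<delta>: "0 < \<delta>"
    and dom: "\<And>n. N \<le> n \<Longrightarrow> \<delta> * t n \<le> a n * (1 + sum a {1..n})"
  shows "summable (block_rms t)"
proof -
  define \<beta> where "\<beta> n = sqrt (\<Sum>k\<in>dyadic_block n. (a k)\<^sup>2)" for n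
  define W where "W n = 1 + sum a {1..<2 ^ Suc n}" for n
  define Z where "Z n = W n / sqrt (2 ^ n)" for n
  have W_ge: "1 \<le> W n" for n using a by (simp add: W_def sum_nonneg)
  have \<beta>_sq: "(\<beta> n)\<^sup>2 = (\<Sum>k\<in>dyadic_block n. (a k)\<^sup>2)" for n by (simp add: \<beta>_def sum_nonneg)
  have \<beta>_nonneg: "0 \<le> \<beta> n" for n by (simp add: \<beta>_def sum_nonneg)
  have sm\<beta>: "summable (\<lambda>n. (\<beta> n)\<^sup>2)"
    unfolding \<beta>_sq using sm by (subst summable_iff_dyadic_block_sums[symmetric]) auto
  have block_sum: "sum a (dyadic_block n) \<le> sqrt (2 ^ n) * \<beta> n" for n
  proof -
    have "(sum a (dyadic_block n))\<^sup>2 \<le> (\<Sum>k\<in>dyadic_block n. (a k)\<^sup>2) * card (dyadic_block n)"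
      by (rule sum_squared_le_sum_of_squares)
    then have "sum a (dyadic_block n) \<le> sqrt ((\<Sum>k\<in>dyadic_block n. (a k)\<^sup>2) * card (dyadic_block n))"
      by (rule real_le_rsqrt)
    then show ?thesis by (simp add: \<beta>_def real_sqrt_mult mult.commute)
  qed
  have Z_nonneg: "0 \<le> Z n" for n using W_ge[of n] by (simp add: Z_def)
  have Z_rec: "Z (Suc n) \<le> \<beta> (Suc n) + Z n / sqrt 2" for n
  proof -
    have "W (Suc n) \<le> W n + sqrt (2 ^ Suc n) * \<beta> (Suc n)"
      using block_sum[of "Suc n"] unfolding W_def sum_up_to_power_of_2 by simp
    then have "W (Suc n) / sqrt (2 ^ Suc n) \<le> (W n + sqrt (2 ^ Suc n) * \<beta> (Suc n)) / sqrt (2 ^ Suc n)"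
      by (intro divide_right_mono) auto
    then show ?thesis by (simp add: Z_def add_divide_distrib real_sqrt_mult mult.commute[of "sqrt 2"])
  qed
  have "summable (\<lambda>n. (Z n)\<^sup>2)"
  proof (rule summable_contractive_recursion)
    show "summable (\<lambda>n. 3 * (\<beta> (Suc n))\<^sup>2)" using sm\<beta> by (subst summable_Suc_iff) auto
    show "(Z (Suc n))\<^sup>2 \<le> 3 * (\<beta> (Suc n))\<^sup>2 + 3 / 4 * (Z n)\<^sup>2" for n
    proof -
      define u where "u = Z n / sqrt 2"
      have "(Z (Suc n))\<^sup>2 \<le> (\<beta> (Suc n) + u)\<^sup>2"
        unfolding u_def by (rule power_mono[OF Z_rec Z_nonneg])
      \<comment> \<open>Weighting the mixed term unevenly keeps the factor of the old square below 1 after halving.\<close>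
      also have "\<dots> \<le> 3 * (\<beta> (Suc n))\<^sup>2 + 3 / 2 * u\<^sup>2"
        using zero_le_power2[of "2 * \<beta> (Suc n) - u"] by (simp add: power2_eq_square algebra_simps)
      also have "u\<^sup>2 = (Z n)\<^sup>2 / 2" by (simp add: u_def power_divide)
      finally show ?thesis by simp
    qed
  qed auto
  then have "summable (\<lambda>n. ((\<beta> n)\<^sup>2 + (Z n)\<^sup>2) / \<delta>)"
    using sm\<beta> by (intro summable_divide summable_add)
  then show ?thesis
  proof (rule summable_comparison_test'[where N = N])
    fix n assume n: "N \<le> n"
    have "(\<delta> * t k)\<^sup>2 \<le> (a k * W n)\<^sup>2" if k: "k \<in> dyadic_block n" for k
    proof (rule power_mono)
      have "n < 2 ^ n" by (rule less_exp)
      also have "2 ^ n \<le> k" using k by (simp add: dyadic_block_eq)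
      finally have "n < k" .
      have "\<delta> * t k \<le> a k * (1 + sum a {1..k})" using n \<open>n < k\<close> by (intro dom) auto
      also have "\<dots> \<le> a k * W n"
        unfolding W_def using k a
        by (intro mult_left_mono add_left_mono sum_mono2) (auto simp: dyadic_block_eq)
      finally show "\<delta> * t k \<le> a k * W n" .
      show "0 \<le> \<delta> * t k" using t[of k] \<delta> \<open>n < k\<close> by simp
    qed
    then have "(\<Sum>k\<in>dyadic_block n. (\<delta> * t k)\<^sup>2) \<le> (\<Sum>k\<in>dyadic_block n. (a k * W n)\<^sup>2)" by (rule sum_mono)
    then have "\<delta>\<^sup>2 * (\<Sum>k\<in>dyadic_block n. (t k)\<^sup>2) \<le> (\<beta> n)\<^sup>2 * (W n)\<^sup>2"
      by (simp add: \<beta>_sq power_mult_distrib sum_distrib_left sum_distrib_right)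
    then have "sqrt (\<delta>\<^sup>2 * (\<Sum>k\<in>dyadic_block n. (t k)\<^sup>2)) \<le> sqrt ((\<beta> n)\<^sup>2 * (W n)\<^sup>2)" by (rule real_sqrt_le_mono)
    then have "\<delta> * sqrt (\<Sum>k\<in>dyadic_block n. (t k)\<^sup>2) \<le> \<beta> n * W n"
      using \<delta> \<beta>_nonneg[of n] W_ge[of n] by (simp add: real_sqrt_mult)
    then have "\<delta> * sqrt (\<Sum>k\<in>dyadic_block n. (t k)\<^sup>2) / sqrt (2 ^ n) \<le> \<beta> n * W n / sqrt (2 ^ n)"
      by (intro divide_right_mono) auto
    then have "\<delta> * block_rms t n \<le> \<beta> n * Z n"
      by (simp add: block_rms_def Z_def real_sqrt_divide)
    also have "\<dots> \<le> (\<beta> n)\<^sup>2 + (Z n)\<^sup>2"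
      using zero_le_power2[of "\<beta> n - Z n"] zero_le_power2[of "\<beta> n + Z n"]
      by (simp add: power2_diff power2_sum)
    finally show "norm (block_rms t n) \<le> ((\<beta> n)\<^sup>2 + (Z n)\<^sup>2) / \<delta>"
      using \<delta> block_rms_nonneg[of t n] by (simp add: field_simps)
  qed
qed

end

section \<open>Convergence of the residuals\<close>

context inner_product_space
begin

lemma cnj_in_K: "z \<in> K \<Longrightarrow> cnj z \<in> K"
  using scalars by (auto simp: complex_is_Real_iff)

text \<open>Multiplying \<open>x\<close> by the conjugate of \<open>ip x y\<close>, which lies in
  \<open>K\<close> in both the real and the complex case, makes the inner product real and nonnegative, and
  so reduces the claim to the bound for the real part.\<close>

lemma Cauchy_Schwarz:
  assumes x: "x \<in> carrier H" and y: "y \<in> carrier H"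
  shows "cmod (ip x y) \<le> hnorm x * hnorm y"
proof (cases "ip x y = 0")
  case True
  then show ?thesis using hnorm_nonneg x y by simp
next
  case False
  define z where "z = ip x y"
  have zK: "cnj z \<in> K" unfolding z_def using x y by (intro cnj_in_K ip_closed)
  have zz: "cnj z * z = complex_of_real ((cmod z)\<^sup>2)" by (simp only: complex_norm_square mult.commute)
  have zx: "cnj z \<odot> x \<in> carrier H" using zK x by (rule smult_in)
  have "Re (ip (cnj z \<odot> x) (cnj z \<odot> x)) = (cmod z)\<^sup>2 * (hnorm x)\<^sup>2"
  proof -
    have "ip x x = complex_of_real ((hnorm x)\<^sup>2)"
      using ip_commute[OF x x] hnorm_sq[OF x] by (simp add: complex_eq_iff)
    then have "ip (cnj z \<odot> x) (cnj z \<odot> x) = (cnj z * z) * complex_of_real ((hnorm x)\<^sup>2)"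
      using zK x zx by (simp add: ip_smult_left ip_smult_right)
    also note zz
    finally show ?thesis by (simp flip: of_real_mult of_real_power)
  qed
  then have norm_zx: "hnorm (cnj z \<odot> x) = cmod z * hnorm x"
    using hnorm_nonneg[OF x] by (simp add: hnorm_def[of "cnj z \<odot> x"] real_sqrt_mult)
  have "ip (cnj z \<odot> x) y = cnj z * z" using zK x y by (simp add: ip_smult_left z_def)
  then have "(cmod z)\<^sup>2 = Re (ip (cnj z \<odot> x) y)" unfolding zz by (simp only: Re_complex_of_real)
  also have "\<dots> \<le> hnorm (cnj z \<odot> x) * hnorm y" using Re_Cauchy_Schwarz[OF zx y] by simp
  finally have "cmod z * cmod z \<le> cmod z * (hnorm x * hnorm y)"
    by (simp add: norm_zx power2_eq_square mult.assoc)
  then show ?thesis using False by (simp add: z_def)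
qed

lemma hdist_eq: "\<lbrakk>x \<in> carrier H; y \<in> carrier H\<rbrakk> \<Longrightarrow> hdist x y = hnorm (x \<ominus> y)"
  by (simp add: hdist_def)

lemma ip_unit: "\<lbrakk>g \<in> carrier H; hnorm g = 1\<rbrakk> \<Longrightarrow> ip g g = 1"
  using ip_commute[of g g] hnorm_sq[of g] by (simp add: complex_eq_iff)

lemma dictionary_in_carrier: "\<lbrakk>dictionary D; g \<in> D\<rbrakk> \<Longrightarrow> g \<in> carrier H"
  and dictionary_unit: "\<lbrakk>dictionary D; g \<in> D\<rbrakk> \<Longrightarrow> hnorm g = 1"
  by (auto simp: dictionary_def)

lemma ip_finsum_left_zero:
  assumes "finite S" "S \<subseteq> carrier H" "\<forall>g\<in>S. c g \<in> K" "h \<in> carrier H" "\<And>g. g \<in> S \<Longrightarrow> ip h g = 0"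
  shows "(\<Oplus>g\<in>S. c g \<odot> g) \<in> carrier H \<and> ip h (\<Oplus>g\<in>S. c g \<odot> g) = 0"
  using assms
proof (induction S rule: finite_induct)
  case empty
  then show ?case using ip_add_right[of \<zero> \<zero> h] by simp
next
  case (insert g S)
  have "(\<lambda>g. c g \<odot> g) \<in> S \<rightarrow> carrier H" using insert.prems by (auto intro: smult_in)
  moreover have "c g \<odot> g \<in> carrier H" using insert.prems by (auto intro: smult_in)
  ultimately show ?case using insert by (simp add: M.finsum_insert ip_add_right ip_smult_right)
qed

lemma orthogonal_to_dictionary_is_zero:
  assumes D: "dictionary D" and h: "h \<in> carrier H" and orth: "\<And>g. g \<in> D \<Longrightarrow> ip h g = 0"
  shows "h = \<zero>"
proof (rule ccontr)
  assume "h \<noteq> \<zero>"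
  then have pos: "0 < hnorm h" using ip_pos[OF h] by (simp add: hnorm_def)
  have "h \<in> mtopology closure_of lin_span D" using D h by (simp add: dictionary_def)
  then obtain y where y: "y \<in> lin_span D" "y \<in> mball h (hnorm h)"
    using pos by (auto simp: metric_closure_of)
  have orth_span: "ip h y = 0" and yc: "y \<in> carrier H"
    using y(1) ip_finsum_left_zero[OF _ _ _ h] orth dictionary_in_carrier[OF D]
    unfolding lin_span_def by (blast, blast)
  have "hnorm (h \<ominus> y) < hnorm h" using y(2) h yc by (simp add: hdist_eq)
  have "(hnorm h)\<^sup>2 = Re (ip h (h \<ominus> y))" using h yc by (simp add: hnorm_sq ip_diff_right orth_span)
  also have "\<dots> \<le> hnorm h * hnorm (h \<ominus> y)" using Re_Cauchy_Schwarz[of h "h \<ominus> y"] h yc by simp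
  also have "\<dots> < hnorm h * hnorm h" using pos \<open>hnorm (h \<ominus> y) < hnorm h\<close> by simp
  finally show False by (simp add: power2_eq_square)
qed

lemma residual_in_carrier:
  assumes "f \<in> carrier H" "\<And>n. n \<ge> 1 \<Longrightarrow> \<phi> n \<in> carrier H"
  shows "residual f \<phi> n \<in> carrier H"
  using assms by (induction n) (auto intro!: M.minus_closed smult_in ip_closed)

lemma approximant_eq:
  assumes f: "f \<in> carrier H" and \<phi>: "\<And>n. n \<ge> 1 \<Longrightarrow> \<phi> n \<in> carrier H"
  shows "approximant f \<phi> n \<in> carrier H \<and> f = approximant f \<phi> n \<oplus> residual f \<phi> n"
proof (induction n)
  case 0
  then show ?case using f by (simp add: approximant_def)
next
  case (Suc n)
  let ?r = "residual f \<phi> n" and ?p = "ip (residual f \<phi> n) (\<phi> (Suc n)) \<odot> \<phi> (Suc n)"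
  have r: "residual f \<phi> m \<in> carrier H" for m by (rule residual_in_carrier[OF f \<phi>])
  have p: "ip (residual f \<phi> m) (\<phi> (Suc m)) \<odot> \<phi> (Suc m) \<in> carrier H" for m
    using r \<phi> by (intro smult_in ip_closed) auto
  have "(\<lambda>j. ip (residual f \<phi> (j - 1)) (\<phi> j) \<odot> \<phi> j) \<in> {1..n} \<rightarrow> carrier H"
  proof
    fix j assume "j \<in> {1..n}"
    then show "ip (residual f \<phi> (j - 1)) (\<phi> j) \<odot> \<phi> j \<in> carrier H" using p[of "j - 1"] by simp
  qed
  moreover have "{1..Suc n} = insert (Suc n) {1..n}" by auto
  ultimately have a: "approximant f \<phi> (Suc n) = ?p \<oplus> approximant f \<phi> n"
    using p[of n] unfolding approximant_def by (simp add: M.finsum_insert)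
  have ac: "approximant f \<phi> n \<in> carrier H" using Suc by simp
  have "f = approximant f \<phi> n \<oplus> ?r" using Suc by simp
  also have "\<dots> = (?p \<oplus> approximant f \<phi> n) \<oplus> (?r \<ominus> ?p)"
  proof -
    have "(?p \<oplus> approximant f \<phi> n) \<oplus> (?r \<ominus> ?p) = (approximant f \<phi> n \<oplus> ?r) \<oplus> (?p \<oplus> (\<ominus> ?p))"
      using p[of n] ac r by (simp add: a_minus_def M.a_ac)
    then show ?thesis using p[of n] ac r by (simp add: M.r_neg)
  qed
  finally show ?case using a p[of n] ac by simp
qed

text \<open>Approximant and residual always add up to the target, so convergence can be read off the
  residuals.\<close>

lemma limitin_approximant_iff:
  assumes f: "f \<in> carrier H" and \<phi>: "\<And>n. n \<ge> 1 \<Longrightarrow> \<phi> n \<in> carrier H"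
  shows "limitin mtopology (approximant f \<phi>) f sequentially \<longleftrightarrow> (\<lambda>n. hnorm (residual f \<phi> n)) \<longlonglongrightarrow> 0"
proof -
  have "hdist (approximant f \<phi> n) f = hnorm (residual f \<phi> n)" for n
  proof -
    let ?a = "approximant f \<phi> n" and ?r = "residual f \<phi> n"
    have a: "?a \<in> carrier H" and fe: "f = ?a \<oplus> ?r" using approximant_eq[of f \<phi> n, OF f \<phi>] by auto
    have r: "?r \<in> carrier H" by (rule residual_in_carrier[OF f \<phi>])
    have "(?a \<oplus> ?r) \<ominus> ?a = ?r \<oplus> (?a \<oplus> (\<ominus> ?a))" using a r by (simp add: a_minus_def M.a_ac)
    also have "\<dots> = ?r" using a r by (simp add: M.r_neg)
    finally have "f \<ominus> ?a = ?r" by (simp only: fe[symmetric])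
    then show ?thesis using hdist_eq[OF f a] commute[of f ?a] by simp
  qed
  then show ?thesis
    using f approximant_eq[of f \<phi>, OF f \<phi>] by (simp add: limitin_metric_dist_null)
qed

end

context hilbert_space
begin

text \<open>The set of good indices, where the residual is almost orthogonal to the dictionary even after
  multiplication by the sum of all previous coefficients, is infinite because the block series diverges. For
  \<open>m \<le> n\<close> with \<open>n\<close> good, \<open>r m - r n\<close> is nearly orthogonal to
  \<open>r n\<close>, so its squared norm is nearly the difference of squared norms, which tends to zero.
  Any two late residuals are therefore both close to a later good one.\<close>

lemma wga_residual_tends_to_zero:
  assumes t: "\<And>j. j \<ge> 1 \<Longrightarrow> 0 \<le> t j \<and> t j \<le> 1" and div: "\<not> summable (block_rms t)"
    and D: "dictionary D" and f: "f \<in> carrier H" and choice: "weak_greedy_choice t D f \<phi>"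
  shows "(\<lambda>n. hnorm (residual f \<phi> n)) \<longlonglongrightarrow> 0"
proof -
  have \<phi>D: "\<phi> n \<in> D" if "n \<ge> 1" for n using choice that by (simp add: weak_greedy_choice_def)
  have \<phi>: "\<phi> n \<in> carrier H" if "n \<ge> 1" for n using \<phi>D[OF that] dictionary_in_carrier[OF D] by blast
  have \<phi>1: "hnorm (\<phi> n) = 1" if "n \<ge> 1" for n using \<phi>D[OF that] dictionary_unit[OF D] by blast
  define r where "r = residual f \<phi>"
  have r: "r n \<in> carrier H" for n unfolding r_def by (rule residual_in_carrier[OF f \<phi>])
  define c where "c n = ip (r (n - 1)) (\<phi> n)" for n
  define a where "a n = cmod (c n)" for n
  have a_nonneg: "0 \<le> a n" for n by (simp add: a_def)
  have cK: "c n \<in> K" if "n \<ge> 1" for n unfolding c_def using r \<phi>[OF that] by (rule ip_closed)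
  have c\<phi>: "c n \<odot> \<phi> n \<in> carrier H" if "n \<ge> 1" for n using cK \<phi> that by (intro smult_in)
  have r_Suc: "r (Suc n) = r n \<ominus> c (Suc n) \<odot> \<phi> (Suc n)" for n by (simp add: r_def c_def)
  have pyth: "(hnorm (r (Suc n)))\<^sup>2 = (hnorm (r n))\<^sup>2 - (a (Suc n))\<^sup>2" for n
  proof -
    have [simp]: "Suc n \<ge> 1" by simp
    have "ip (r n) (\<phi> (Suc n)) = c (Suc n)" by (simp add: c_def)
    moreover have "ip (\<phi> (Suc n)) (r n) = cnj (c (Suc n))" using ip_commute[OF \<phi> r] by (simp add: c_def)
    ultimately have "ip (r (Suc n)) (r (Suc n)) = ip (r n) (r n) - c (Suc n) * cnj (c (Suc n))"
      using r c\<phi>[of "Suc n"] cK[of "Suc n"] \<phi>[of "Suc n"] ip_unit[OF \<phi> \<phi>1, of "Suc n"]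
      by (simp add: r_Suc ip_diff_left ip_diff_right ip_smult_left ip_smult_right algebra_simps)
    then show ?thesis
      by (simp add: hnorm_sq r a_def complex_mult_cnj cmod_power2)
  qed
  have energy_sum: "(\<Sum>m<n. (a (m + 1))\<^sup>2) = (hnorm (r 0))\<^sup>2 - (hnorm (r n))\<^sup>2" for n
    using pyth by (induction n) auto
  have sm_a: "summable (\<lambda>m. (a (m + 1))\<^sup>2)"
    by (rule summable_nonneg_bounded[where C = "(hnorm (r 0))\<^sup>2"]) (simp, simp only: energy_sum, simp)
  have good: "\<exists>n\<ge>N. a (Suc n) * (1 + sum a {1..Suc n}) < \<delta> * t (Suc n)" if \<delta>: "0 < \<delta>" for \<delta> N
  proof (rule ccontr)
    assume "\<not> ?thesis"
    then have le: "\<delta> * t (Suc n) \<le> a (Suc n) * (1 + sum a {1..Suc n})" if "n \<ge> N" for n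
      using that by (auto simp: not_less)
    have "\<delta> * t n \<le> a n * (1 + sum a {1..n})" if "n \<ge> Suc N" for n
      using le[of "n - 1"] that by simp
    then have "summable (block_rms t)"
      using summable_block_rms_if_dominated[of t a \<delta> "Suc N", OF t a_nonneg sm_a \<delta>] by simp
    then show False using div by simp
  qed
  have bdd: "bdd_above ((\<lambda>g. cmod (ip (r n) g)) ` D)" for n
  proof (rule bdd_aboveI2[where M = "hnorm (r n)"])
    fix g assume "g \<in> D"
    then show "cmod (ip (r n) g) \<le> hnorm (r n)"
      using Cauchy_Schwarz[of "r n" g] r dictionary_in_carrier[OF D] dictionary_unit[OF D] by simp
  qed
  have greedy: "t (Suc n) * cmod (ip (r n) g) \<le> a (Suc n)" if "g \<in> D" for n g
  proof -
    have "t (Suc n) * cmod (ip (r n) g) \<le> t (Suc n) * (SUP g\<in>D. cmod (ip (r n) g))"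
      using t[of "Suc n"] by (intro mult_left_mono cSUP_upper that bdd) auto
    also have "\<dots> \<le> a (Suc n)"
      using choice[unfolded weak_greedy_choice_def, rule_format, of "Suc n"] by (simp add: a_def c_def r_def)
    finally show ?thesis .
  qed
  \<comment> \<open>The first bound makes the limit of the residuals orthogonal to the dictionary, the second makes the residuals Cauchy.\<close>
  have flat: "\<exists>n\<ge>N. (\<forall>g\<in>D. cmod (ip (r n) g) \<le> \<delta>) \<and> (\<forall>g\<in>D. cmod (ip (r n) g) * sum a {1..n} \<le> \<delta>)"
    if \<delta>: "0 < \<delta>" for \<delta> N
  proof -
    obtain n where n: "n \<ge> N" "a (Suc n) * (1 + sum a {1..Suc n}) < \<delta> * t (Suc n)" using good[OF \<delta>] by blast
    have S: "0 \<le> sum a {1..n}" "sum a {1..n} \<le> sum a {1..Suc n}" using a_nonneg by (auto intro: sum_nonneg)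
    have "0 \<le> a (Suc n) * (1 + sum a {1..Suc n})" using a_nonneg S by (intro mult_nonneg_nonneg) auto
    then have tpos: "0 < t (Suc n)" using n(2) \<delta> by (meson le_less_trans zero_less_mult_pos)
    have "cmod (ip (r n) g) * (1 + sum a {1..n}) \<le> \<delta>" if g: "g \<in> D" for g
    proof -
      have "t (Suc n) * (cmod (ip (r n) g) * (1 + sum a {1..n})) = (t (Suc n) * cmod (ip (r n) g)) * (1 + sum a {1..n})"
        by simp
      also have "\<dots> \<le> a (Suc n) * (1 + sum a {1..Suc n})"
        using greedy[OF g] S a_nonneg by (intro mult_mono) auto
      also have "\<dots> \<le> t (Suc n) * \<delta>" using n(2) by (simp add: mult.commute)
      finally show ?thesis using tpos by simp
    qed
    moreover have "cmod (ip (r n) g) \<le> cmod (ip (r n) g) * (1 + sum a {1..n})"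
      "cmod (ip (r n) g) * sum a {1..n} \<le> cmod (ip (r n) g) * (1 + sum a {1..n})" for g
      using S by (simp_all add: algebra_simps)
    ultimately show ?thesis using n(1) by (meson order_trans)
  qed
  have diff: "cmod (ip (r m) h - ip (r (m + k)) h) \<le> B * sum a {m + 1..m + k}"
    if h: "h \<in> carrier H" and B: "\<And>j. j \<ge> 1 \<Longrightarrow> cmod (ip (\<phi> j) h) \<le> B" for h B m k
  proof (induction k)
    case (Suc k)
    let ?j = "Suc (m + k)"
    have "ip (r ?j) h = ip (r (m + k)) h - c ?j * ip (\<phi> ?j) h"
      using r_Suc[of "m + k"] r c\<phi>[of ?j] cK[of ?j] \<phi>[of ?j] h by (simp add: ip_diff_left ip_smult_left)
    then have "ip (r m) h - ip (r ?j) h = (ip (r m) h - ip (r (m + k)) h) + c ?j * ip (\<phi> ?j) h" by simp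
    then have "cmod (ip (r m) h - ip (r ?j) h) \<le> cmod (ip (r m) h - ip (r (m + k)) h) + cmod (c ?j * ip (\<phi> ?j) h)"
      by (simp only: norm_triangle_ineq)
    also have "cmod (c ?j * ip (\<phi> ?j) h) \<le> a ?j * B"
      unfolding norm_mult a_def[symmetric] using B a_nonneg by (intro mult_left_mono) auto
    finally show ?case using Suc by (simp add: algebra_simps)
  qed simp
  have norm_mono: "(hnorm (r (m + k)))\<^sup>2 \<le> (hnorm (r m))\<^sup>2" for m k
  proof (induction k)
    case (Suc k)
    then show ?case
      using pyth[of "m + k"] zero_le_power2[of "a (Suc (m + k))"] unfolding add_Suc_right by linarith
  qed simp
  obtain \<rho> where \<rho>: "(\<lambda>n. (hnorm (r n))\<^sup>2) \<longlonglongrightarrow> \<rho>" "\<And>n. \<rho> \<le> (hnorm (r n))\<^sup>2"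
  proof -
    have dec: "decseq (\<lambda>n. (hnorm (r n))\<^sup>2)"
      unfolding decseq_def
    proof (intro allI impI)
      fix m n :: nat assume "m \<le> n"
      then show "(hnorm (r n))\<^sup>2 \<le> (hnorm (r m))\<^sup>2" using norm_mono[of m "n - m"] by simp
    qed
    have "\<forall>i. 0 \<le> (hnorm (r i))\<^sup>2" by simp
    from decseq_convergent[OF dec this] show ?thesis using that by blast
  qed
  have Cauchy: "MCauchy r"
    unfolding MCauchy_def
  proof (intro conjI allI impI)
    show "range r \<subseteq> carrier H" using r by auto
    fix \<epsilon> :: real assume \<epsilon>: "0 < \<epsilon>"
    \<comment> \<open>Squared distances to a good residual will be at most \<open>3 * \<delta> < (\<epsilon> / 2) ^ 2\<close>.\<close>
    define \<delta> where "\<delta> = \<epsilon>\<^sup>2 / 16"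
    have \<delta>: "0 < \<delta>" using \<epsilon> by (simp add: \<delta>_def)
    have "\<forall>\<^sub>F n in sequentially. (hnorm (r n))\<^sup>2 < \<rho> + \<delta>" using \<rho>(1) by (rule order_tendstoD) (use \<delta> in simp)
    then obtain N where N: "\<And>n. N \<le> n \<Longrightarrow> (hnorm (r n))\<^sup>2 < \<rho> + \<delta>" by (auto simp: eventually_sequentially)
    have close: "\<forall>m n. N \<le> m \<longrightarrow> m \<le> n \<longrightarrow> (\<forall>g\<in>D. cmod (ip (r n) g) * sum a {1..n} \<le> \<delta>) \<longrightarrow> (hnorm (r m \<ominus> r n))\<^sup>2 \<le> 3 * \<delta>"
    proof (intro allI impI)
      fix m n assume mn: "N \<le> m" "m \<le> n" and fl: "\<forall>g\<in>D. cmod (ip (r n) g) * sum a {1..n} \<le> \<delta>"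
      define A where "A = sum a {1..n}"
      have A: "0 \<le> A" unfolding A_def using a_nonneg by (auto intro: sum_nonneg)
      have "cmod (ip (r m) (r n) - ip (r n) (r n)) \<le> \<delta>"
      proof (cases "A = 0")
        case True
        then have "a j = 0" if "j \<in> {1..n}" for j
          using that a_nonneg unfolding A_def by (simp add: sum_nonneg_eq_0_iff)
        then have "sum a {m + 1..m + (n - m)} = 0" using mn by (intro sum.neutral) auto
        moreover have "cmod (ip (\<phi> j) (r n)) \<le> hnorm (r n)" if "j \<ge> 1" for j
          using Cauchy_Schwarz[OF \<phi> r, of j n] \<phi>1 that by simp
        ultimately show ?thesis using diff[OF r, of n "hnorm (r n)" m "n - m"] mn \<delta> by simp
      next
        case False
        then have Apos: "0 < A" using A by simp
        have "cmod (ip (\<phi> j) (r n)) \<le> \<delta> / A" if "j \<ge> 1" for j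
        proof -
          have "cmod (ip (r n) (\<phi> j)) * A \<le> \<delta>" using fl \<phi>D[OF that] by (auto simp: A_def)
          moreover have "cmod (ip (\<phi> j) (r n)) = cmod (ip (r n) (\<phi> j))"
            using ip_commute[OF \<phi>[OF that] r[of n]] by simp
          ultimately show ?thesis using Apos by (simp add: field_simps)
        qed
        then have "cmod (ip (r m) (r n) - ip (r n) (r n)) \<le> \<delta> / A * sum a {m + 1..n}"
          using diff[OF r, of n "\<delta> / A" m "n - m"] mn by simp
        also have "\<dots> \<le> \<delta> / A * A"
          unfolding A_def using \<delta> A a_nonneg by (intro mult_left_mono sum_mono2) (auto simp: A_def)
        finally show ?thesis using Apos by simp
      qed
      then have "\<bar>Re (ip (r m) (r n)) - Re (ip (r n) (r n))\<bar> \<le> \<delta>"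
        by (metis abs_Re_le_cmod minus_complex.sel(1) order_trans)
      moreover have "(hnorm (r m \<ominus> r n))\<^sup>2 = (hnorm (r m))\<^sup>2 + (hnorm (r n))\<^sup>2 - 2 * Re (ip (r m) (r n))"
        using r Re_ip_commute[OF r r, of m n] by (simp add: hnorm_sq ip_diff_left ip_diff_right)
      moreover have "(hnorm (r n))\<^sup>2 = Re (ip (r n) (r n))" using r by (simp add: hnorm_sq)
      ultimately show "(hnorm (r m \<ominus> r n))\<^sup>2 \<le> 3 * \<delta>"
        using N[OF mn(1)] \<rho>(2)[of n] by (simp add: abs_le_iff)
    qed
    have "hdist (r m) (r n) < \<epsilon>" if mn: "N \<le> m" "N \<le> n" for m n
    proof -
      obtain p where p: "p \<ge> max m n" "\<forall>g\<in>D. cmod (ip (r p) g) * sum a {1..p} \<le> \<delta>" using flat[OF \<delta>] by blast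
      have half: "hdist (r l) (r p) < \<epsilon> / 2" if "l = m \<or> l = n" for l
      proof -
        have "(hnorm (r l \<ominus> r p))\<^sup>2 \<le> 3 * \<delta>" using close that p mn by auto
        also have "\<dots> < (\<epsilon> / 2)\<^sup>2" using \<epsilon> by (simp add: \<delta>_def power_divide)
        finally have "hnorm (r l \<ominus> r p) < \<epsilon> / 2" by (rule power2_less_imp_less) (use \<epsilon> in simp)
        then show ?thesis by (simp add: hdist_eq r)
      qed
      have "hdist (r m) (r n) \<le> hdist (r m) (r p) + hdist (r n) (r p)"
        using triangle[OF r[of m] r[of p] r[of n]] unfolding commute[of "r p" "r n"] .
      then show ?thesis using half[of m] half[of n] by simp
    qed
    then show "\<exists>N. \<forall>n n'. N \<le> n \<longrightarrow> N \<le> n' \<longrightarrow> hdist (r n) (r n') < \<epsilon>" by blast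
  qed
  then obtain h where lim: "limitin mtopology r h sequentially" using complete by (auto simp: mcomplete_def)
  then have h: "h \<in> carrier H" and dist0: "(\<lambda>n. hdist (r n) h) \<longlonglongrightarrow> 0"
    by (auto simp: limitin_metric_dist_null)
  have "ip h g = 0" if g: "g \<in> D" for g
  proof (rule ccontr)
    assume "ip h g \<noteq> 0"
    define \<delta> where "\<delta> = cmod (ip h g) / 2"
    have \<delta>: "0 < \<delta>" using \<open>ip h g \<noteq> 0\<close> by (simp add: \<delta>_def)
    have gc: "g \<in> carrier H" "hnorm g = 1" using dictionary_in_carrier[OF D g] dictionary_unit[OF D g] by auto
    have "\<forall>\<^sub>F n in sequentially. hdist (r n) h < \<delta>" using dist0 \<delta> by (rule order_tendstoD)
    then obtain N where N: "\<And>n. N \<le> n \<Longrightarrow> hdist (r n) h < \<delta>" by (auto simp: eventually_sequentially)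
    obtain n where n: "n \<ge> N" "cmod (ip (r n) g) \<le> \<delta>" using flat[OF \<delta>] g by blast
    have "cmod (ip (r n \<ominus> h) g) < \<delta>"
      using Cauchy_Schwarz[of "r n \<ominus> h" g] r h gc N[OF n(1)] by (simp add: hdist_eq)
    moreover have "ip h g = ip (r n) g - ip (r n \<ominus> h) g" using r h gc by (simp add: ip_diff_left)
    ultimately have "cmod (ip h g) < 2 * \<delta>" using n(2) norm_triangle_ineq4[of "ip (r n) g" "ip (r n \<ominus> h) g"] by simp
    then show False by (simp add: \<delta>_def)
  qed
  then have "h = \<zero>" using orthogonal_to_dictionary_is_zero[OF D h] by blast
  moreover have "r n \<ominus> \<zero> = r n" for n using r by (simp add: a_minus_def)
  ultimately show ?thesis using dist0 r by (simp add: hdist_eq r_def)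
qed

lemma wga_converges_in_if_not_summable:
  assumes "\<And>j. j \<ge> 1 \<Longrightarrow> 0 \<le> t j \<and> t j \<le> 1" and "\<not> summable (block_rms t)"
  shows "wga_converges_in t"
  unfolding wga_converges_in_def
proof (intro allI impI, elim conjE)
  fix D f \<phi> assume *: "dictionary D" "f \<in> carrier H" "weak_greedy_choice t D f \<phi>"
  have "\<phi> n \<in> carrier H" if "n \<ge> 1" for n
    using * that dictionary_in_carrier[OF *(1)] by (simp add: weak_greedy_choice_def)
  then show "limitin mtopology (approximant f \<phi>) f sequentially"
    using wga_residual_tends_to_zero[OF assms *] by (simp add: limitin_approximant_iff *)
qed

end

section \<open>Square-summable families as a Hilbert space inside a given type\<close>

lemma cring_scalar_field:
  assumes "K = \<real> \<or> K = UNIV"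
  shows "cring (scalar_field K)"
proof (rule cringI)
  have K: "x + y \<in> K" "x * y \<in> K" "- x \<in> K" if "x \<in> K" "y \<in> K" for x y using assms that by auto
  have K1: "0 \<in> K" "1 \<in> K" using assms by auto
  show "abelian_group (scalar_field K)"
  proof (rule abelian_groupI)
    fix x assume "x \<in> carrier (scalar_field K)"
    then show "\<exists>y\<in>carrier (scalar_field K). y \<oplus>\<^bsub>scalar_field K\<^esub> x = \<zero>\<^bsub>scalar_field K\<^esub>"
      using K[of x x] by (intro bexI[of _ "- x"]) (auto simp: scalar_field_def)
  qed (use K K1 in \<open>auto simp: scalar_field_def\<close>)
  show "Group.comm_monoid (scalar_field K)"
    by (rule comm_monoidI) (use K K1 in \<open>auto simp: scalar_field_def\<close>)
qed (simp add: scalar_field_def algebra_simps)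

definition l2_vectors :: "complex set \<Rightarrow> ('i \<Rightarrow> complex) set" where
  "l2_vectors K = {x. range x \<subseteq> K \<and> (\<lambda>i. (cmod (x i))\<^sup>2) summable_on UNIV}"

text \<open>The ambient type may be any type with at least continuum many elements, so the Hilbert space of
  the counterexample is carried over to it by an injection \<open>J\<close> of all coordinate
  families.\<close>

locale l2_copy =
  fixes K :: "complex set" and J :: "('i \<Rightarrow> complex) \<Rightarrow> 'a"
  assumes scalars: "K = \<real> \<or> K = UNIV" and inj: "inj J"
begin

definition coord :: "'a \<Rightarrow> 'i \<Rightarrow> complex" where "coord = inv_into UNIV J"

lemma coord_J [simp]: "coord (J x) = x"
  using inj by (simp add: coord_def)

definition l2_space :: "(complex, 'a) module" where
  "l2_space = \<lparr>carrier = J ` l2_vectors K, monoid.mult = undefined, one = undefined,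
     zero = J (\<lambda>_. 0), add = (\<lambda>x y. J (\<lambda>i. coord x i + coord y i)),
     smult = (\<lambda>a x. J (\<lambda>i. a * coord x i))\<rparr>"

definition l2_inner :: "'a \<Rightarrow> 'a \<Rightarrow> complex" where
  "l2_inner x y = (\<Sum>\<^sub>\<infinity>i. coord x i * cnj (coord y i))"

lemma l2_space_simps [simp]:
  "carrier l2_space = J ` l2_vectors K" "\<zero>\<^bsub>l2_space\<^esub> = J (\<lambda>_. 0)"
  "x \<oplus>\<^bsub>l2_space\<^esub> y = J (\<lambda>i. coord x i + coord y i)" "a \<odot>\<^bsub>l2_space\<^esub> x = J (\<lambda>i. a * coord x i)"
  by (simp_all add: l2_space_def)

lemma K_closed: "\<lbrakk>a \<in> K; b \<in> K\<rbrakk> \<Longrightarrow> a + b \<in> K" "\<lbrakk>a \<in> K; b \<in> K\<rbrakk> \<Longrightarrow> a - b \<in> K" "\<lbrakk>a \<in> K; b \<in> K\<rbrakk> \<Longrightarrow> a * b \<in> K"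
  "a \<in> K \<Longrightarrow> cnj a \<in> K" "0 \<in> K" "1 \<in> K" "complex_of_real r \<in> K" "closed K"
  using scalars by (auto simp: complex_is_Real_iff closed_complex_Reals)

lemma l2_D: "x \<in> l2_vectors K \<Longrightarrow> x i \<in> K" "x \<in> l2_vectors K \<Longrightarrow> (\<lambda>i. (cmod (x i))\<^sup>2) summable_on UNIV"
  by (auto simp: l2_vectors_def)

lemma l2_add: "\<lbrakk>x \<in> l2_vectors K; y \<in> l2_vectors K\<rbrakk> \<Longrightarrow> (\<lambda>i. x i + y i) \<in> l2_vectors K"
proof -
  assume x: "x \<in> l2_vectors K" and y: "y \<in> l2_vectors K"
  have "(\<lambda>i. 2 * (cmod (x i))\<^sup>2 + 2 * (cmod (y i))\<^sup>2) summable_on UNIV"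
    using x y by (intro summable_on_add summable_on_cmult_right l2_D)
  then have "(\<lambda>i. (cmod (x i + y i))\<^sup>2) summable_on UNIV"
  proof (rule summable_on_comparison_test)
    fix i
    have "(cmod (x i + y i))\<^sup>2 \<le> (cmod (x i) + cmod (y i))\<^sup>2"
      by (intro power_mono norm_triangle_ineq) simp
    also have "\<dots> \<le> 2 * (cmod (x i))\<^sup>2 + 2 * (cmod (y i))\<^sup>2"
      using zero_le_power2[of "cmod (x i) - cmod (y i)"] by (simp add: power2_eq_square algebra_simps)
    finally show "(cmod (x i + y i))\<^sup>2 \<le> 2 * (cmod (x i))\<^sup>2 + 2 * (cmod (y i))\<^sup>2" .
  qed simp
  then show ?thesis using x y by (auto simp: l2_vectors_def intro: K_closed)
qed

lemma l2_smult: "\<lbrakk>a \<in> K; x \<in> l2_vectors K\<rbrakk> \<Longrightarrow> (\<lambda>i. a * x i) \<in> l2_vectors K"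
  by (auto simp: l2_vectors_def norm_mult power_mult_distrib intro: K_closed summable_on_cmult_right)

lemma l2_zero: "(\<lambda>_. 0) \<in> l2_vectors K"
  by (auto simp: l2_vectors_def K_closed)

lemma l2_prod_summable:
  assumes x: "x \<in> l2_vectors K" and y: "y \<in> l2_vectors K"
  shows "(\<lambda>i. x i * cnj (y i)) summable_on UNIV"
proof (rule abs_summable_summable, rule summable_on_comparison_test)
  show "(\<lambda>i. (cmod (x i))\<^sup>2 + (cmod (y i))\<^sup>2) summable_on UNIV"
    using x y by (intro summable_on_add l2_D)
  show "cmod (x i * cnj (y i)) \<le> (cmod (x i))\<^sup>2 + (cmod (y i))\<^sup>2" for i
    using sum_squares_bound[of "cmod (x i)" "cmod (y i)"]
      mult_nonneg_nonneg[OF norm_ge_zero norm_ge_zero, of "x i" "y i"]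
    unfolding norm_mult complex_mod_cnj by linarith
qed simp

lemma l2_inner_self:
  assumes "x \<in> l2_vectors K"
  shows "l2_inner (J x) (J x) = complex_of_real (\<Sum>\<^sub>\<infinity>i. (cmod (x i))\<^sup>2)"
proof -
  have "l2_inner (J x) (J x) = (\<Sum>\<^sub>\<infinity>i. complex_of_real ((cmod (x i))\<^sup>2))"
    by (simp only: l2_inner_def coord_J complex_norm_square)
  also have "\<dots> = complex_of_real (\<Sum>\<^sub>\<infinity>i. (cmod (x i))\<^sup>2)"
    by (intro infsumI has_sum_of_real has_sum_infsum l2_D assms)
  finally show ?thesis .
qed

lemma l2_inner_product_space: "inner_product_space K l2_space l2_inner"
proof (intro inner_product_space.intro moduleI inner_product_space_axioms.intro cring_scalar_field scalars)
  show "abelian_group l2_space"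
  proof (rule abelian_groupI)
    fix x assume "x \<in> carrier l2_space"
    then obtain u where u: "u \<in> l2_vectors K" "x = J u" by auto
    have "(\<lambda>i. -1 * u i) \<in> l2_vectors K" using K_closed(7)[of "-1"] by (intro l2_smult u) simp
    then show "\<exists>y\<in>carrier l2_space. y \<oplus>\<^bsub>l2_space\<^esub> x = \<zero>\<^bsub>l2_space\<^esub>"
      by (intro bexI[of _ "J (\<lambda>i. -1 * u i)"]) (auto simp: u)
  qed (auto simp: l2_zero algebra_simps intro!: imageI l2_add)
  show "l2_inner x y \<in> K" if xy: "x \<in> carrier l2_space" "y \<in> carrier l2_space" for x y
  proof (cases "K = UNIV")
    case False
    then have K: "K = \<real>" using scalars by simp
    obtain u v where uv: "u \<in> l2_vectors K" "x = J u" "v \<in> l2_vectors K" "y = J v"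
      using xy unfolding l2_space_simps by blast
    have "cnj (u i) = u i" "cnj (v i) = v i" for i
      using l2_D(1)[OF uv(1), of i] l2_D(1)[OF uv(3), of i] K by (auto simp: Reals_cnj_iff)
    then have "cnj (l2_inner x y) = l2_inner x y" by (simp add: l2_inner_def uv flip: infsum_cnj)
    then show ?thesis by (simp add: K Reals_cnj_iff)
  qed simp
  show "l2_inner x y = cnj (l2_inner y x)" for x y
    by (simp add: l2_inner_def mult.commute flip: infsum_cnj)
  show "l2_inner (x \<oplus>\<^bsub>l2_space\<^esub> y) z = l2_inner x z + l2_inner y z"
    if "x \<in> carrier l2_space" "y \<in> carrier l2_space" "z \<in> carrier l2_space" for x y z
    using that by (auto simp: l2_inner_def distrib_right intro!: infsum_add l2_prod_summable)
  show "l2_inner (a \<odot>\<^bsub>l2_space\<^esub> x) y = a * l2_inner x y" for a x y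
    by (simp add: l2_inner_def mult.assoc infsum_cmult_right')
  show "0 < Re (l2_inner x x)" if x: "x \<in> carrier l2_space" "x \<noteq> \<zero>\<^bsub>l2_space\<^esub>" for x
  proof (rule ccontr)
    obtain u where u: "u \<in> l2_vectors K" "x = J u" using x(1) unfolding l2_space_simps by blast
    assume "\<not> 0 < Re (l2_inner x x)"
    then have "(\<Sum>\<^sub>\<infinity>i. (cmod (u i))\<^sup>2) \<le> 0" by (simp add: u l2_inner_self)
    then have "(cmod (u i))\<^sup>2 = 0" for i
      by (rule nonneg_infsum_le_0D) (use l2_D(2)[OF u(1)] in auto)
    then have "u = (\<lambda>_. 0)" by auto
    then show False using x(2) u by simp
  qed
qed (auto simp: scalar_field_def l2_smult algebra_simps)

sublocale inner_product_space K l2_space l2_inner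
  by (rule l2_inner_product_space)

lemma hnorm_J: "x \<in> l2_vectors K \<Longrightarrow> hnorm (J x) = sqrt (\<Sum>\<^sub>\<infinity>i. (cmod (x i))\<^sup>2)"
  by (simp add: hnorm_def l2_inner_self)

lemma minus_J: 
  assumes "x \<in> l2_vectors K" "y \<in> l2_vectors K"
  shows "J x \<ominus>\<^bsub>l2_space\<^esub> J y = J (\<lambda>i. x i - y i)"
proof -
  have "\<ominus>\<^bsub>l2_space\<^esub> J y = J (\<lambda>i. - y i)" using assms minus_eq_smult[of "J y"] by simp
  then show ?thesis by (simp add: a_minus_def)
qed

lemma l2_diff: 
  assumes "x \<in> l2_vectors K" "y \<in> l2_vectors K"
  shows "(\<lambda>i. x i - y i) \<in> l2_vectors K"
  using l2_add[OF assms(1) l2_smult[of "-1" y]] assms(2) K_closed(7)[of "-1"] by simp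

lemma hdist_J:
  assumes "x \<in> l2_vectors K" "y \<in> l2_vectors K"
  shows "hdist (J x) (J y) = sqrt (\<Sum>\<^sub>\<infinity>i. (cmod (x i - y i))\<^sup>2)"
  using assms by (simp add: hdist_def minus_J hnorm_J l2_diff)

lemma finite_sum_le_hdist:
  assumes "x \<in> l2_vectors K" "y \<in> l2_vectors K" "finite F"
  shows "(\<Sum>i\<in>F. (cmod (x i - y i))\<^sup>2) \<le> (hdist (J x) (J y))\<^sup>2"
proof -
  have "(\<Sum>i\<in>F. (cmod (x i - y i))\<^sup>2) \<le> (\<Sum>\<^sub>\<infinity>i. (cmod (x i - y i))\<^sup>2)"
    using assms l2_D(2)[OF l2_diff, of x y] by (intro finite_sum_le_infsum) auto
  then show ?thesis using assms by (simp add: hdist_J infsum_nonneg)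
qed

text \<open>The standard argument: coordinatewise limits exist, and the Cauchy estimate on finite sets of
  coordinates passes to the limit and then to the whole sum.\<close>

lemma l2_complete: "mcomplete"
  unfolding mcomplete_def
proof (intro allI impI)
  fix \<sigma> assume \<sigma>: "MCauchy \<sigma>"
  have "\<sigma> n \<in> J ` l2_vectors K" for n using \<sigma> unfolding MCauchy_def by auto
  then have "\<forall>n. \<exists>u. u \<in> l2_vectors K \<and> \<sigma> n = J u" by blast
  then obtain u where u: "\<And>n. u n \<in> l2_vectors K" "\<And>n. \<sigma> n = J (u n)" by (metis (no_types, lifting))
  have tail: "\<exists>N. \<forall>m n F. N \<le> m \<longrightarrow> N \<le> n \<longrightarrow> finite F \<longrightarrow> (\<Sum>i\<in>F. (cmod (u m i - u n i))\<^sup>2) \<le> \<epsilon>\<^sup>2"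
    if \<epsilon>: "0 < \<epsilon>" for \<epsilon>
  proof -
    obtain N where N: "\<And>m n. N \<le> m \<Longrightarrow> N \<le> n \<Longrightarrow> hdist (\<sigma> m) (\<sigma> n) < \<epsilon>"
      using \<sigma> \<epsilon> unfolding MCauchy_def by blast
    have "(\<Sum>i\<in>F. (cmod (u m i - u n i))\<^sup>2) \<le> \<epsilon>\<^sup>2" if "N \<le> m" "N \<le> n" "finite F" for m n F
    proof -
      have "(\<Sum>i\<in>F. (cmod (u m i - u n i))\<^sup>2) \<le> (hdist (\<sigma> m) (\<sigma> n))\<^sup>2"
        unfolding u(2) by (rule finite_sum_le_hdist[OF u(1) u(1) that(3)])
      also have "\<dots> \<le> \<epsilon>\<^sup>2" using N[OF that(1,2)] by (intro power_mono) auto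
      finally show ?thesis .
    qed
    then show ?thesis by blast
  qed
  have "Cauchy (\<lambda>n. u n i)" for i
  proof (rule metric_CauchyI)
    fix \<epsilon> :: real assume \<epsilon>: "0 < \<epsilon>"
    obtain N where N: "\<And>m n F. N \<le> m \<Longrightarrow> N \<le> n \<Longrightarrow> finite F \<Longrightarrow> (\<Sum>i\<in>F. (cmod (u m i - u n i))\<^sup>2) \<le> (\<epsilon> / 2)\<^sup>2"
      using tail[of "\<epsilon> / 2"] \<epsilon> by auto
    have "dist (u m i) (u n i) < \<epsilon>" if "N \<le> m" "N \<le> n" for m n
    proof -
      have "cmod (u m i - u n i) \<le> \<epsilon> / 2"
      proof (rule power2_le_imp_le)
        show "(cmod (u m i - u n i))\<^sup>2 \<le> (\<epsilon> / 2)\<^sup>2" using N[OF that, of "{i}"] by (simp only: finite.intros sum.insert sum.empty empty_iff not_False_eq_True add_0_right)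
      qed (use \<epsilon> in simp)
      then show ?thesis using \<epsilon> by (simp add: dist_norm)
    qed
    then show "\<exists>N. \<forall>m\<ge>N. \<forall>n\<ge>N. dist (u m i) (u n i) < \<epsilon>" by blast
  qed
  then have "\<exists>l. (\<lambda>n. u n i) \<longlonglongrightarrow> l" for i using Cauchy_convergent convergent_def by blast
  then obtain v where v: "\<And>i. (\<lambda>n. u n i) \<longlonglongrightarrow> v i" by metis
  have vK: "v i \<in> K" for i
    by (rule closed_sequentially[OF K_closed(8) _ v]) (use l2_D(1)[OF u(1)] in blast)
  have lim_tail: "(\<Sum>i\<in>F. (cmod (v i - u n i))\<^sup>2) \<le> \<epsilon>\<^sup>2"
    if N: "\<And>m. k \<le> m \<Longrightarrow> (\<Sum>i\<in>F. (cmod (u m i - u n i))\<^sup>2) \<le> \<epsilon>\<^sup>2" for k n F and \<epsilon> :: real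
  proof (rule tendsto_upperbound)
    show "(\<lambda>m. \<Sum>i\<in>F. (cmod (u m i - u n i))\<^sup>2) \<longlonglongrightarrow> (\<Sum>i\<in>F. (cmod (v i - u n i))\<^sup>2)"
      by (intro tendsto_intros v)
    show "\<forall>\<^sub>F m in sequentially. (\<Sum>i\<in>F. (cmod (u m i - u n i))\<^sup>2) \<le> \<epsilon>\<^sup>2"
      using N by (auto simp: eventually_sequentially)
  qed simp
  have diff_l2: "(\<lambda>i. v i - u n i) \<in> l2_vectors K" if "\<And>F. finite F \<Longrightarrow> (\<Sum>i\<in>F. (cmod (v i - u n i))\<^sup>2) \<le> C" for n C
  proof -
    have "(\<lambda>i. (cmod (v i - u n i))\<^sup>2) summable_on UNIV"
      by (rule nonneg_bdd_above_summable_on) (use that in \<open>auto intro!: bdd_aboveI2[where M = C]\<close>)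
    then show ?thesis using vK l2_D(1)[OF u(1)] by (auto simp: l2_vectors_def intro!: K_closed)
  qed
  have v_l2: "v \<in> l2_vectors K"
  proof -
    obtain N where N: "\<And>m n F. N \<le> m \<Longrightarrow> N \<le> n \<Longrightarrow> finite F \<Longrightarrow> (\<Sum>i\<in>F. (cmod (u m i - u n i))\<^sup>2) \<le> 1\<^sup>2"
      using tail[of 1] by auto
    have "(\<lambda>i. v i - u N i) \<in> l2_vectors K"
    proof (rule diff_l2)
      fix F :: "'i set" assume "finite F"
      then show "(\<Sum>i\<in>F. (cmod (v i - u N i))\<^sup>2) \<le> 1\<^sup>2" by (intro lim_tail[OF N]) auto
    qed
    from l2_add[OF this u(1)[of N]] show ?thesis by simp
  qed
  have "limitin mtopology \<sigma> (J v) sequentially"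
    unfolding limit_metric_sequentially
  proof (intro conjI allI impI)
    show "J v \<in> carrier l2_space" using v_l2 by simp
    fix \<epsilon> :: real assume \<epsilon>: "0 < \<epsilon>"
    obtain N where N: "\<And>m n F. N \<le> m \<Longrightarrow> N \<le> n \<Longrightarrow> finite F \<Longrightarrow> (\<Sum>i\<in>F. (cmod (u m i - u n i))\<^sup>2) \<le> (\<epsilon> / 2)\<^sup>2"
      using tail[of "\<epsilon> / 2"] \<epsilon> by auto
    have "\<sigma> n \<in> carrier l2_space \<and> hdist (\<sigma> n) (J v) < \<epsilon>" if n: "N \<le> n" for n
    proof -
      have "(\<Sum>\<^sub>\<infinity>i. (cmod (v i - u n i))\<^sup>2) \<le> (\<epsilon> / 2)\<^sup>2"
        by (intro infsum_le_finite_sums l2_D l2_diff v_l2 u lim_tail[OF N] n)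
      then have "sqrt (\<Sum>\<^sub>\<infinity>i. (cmod (v i - u n i))\<^sup>2) \<le> \<epsilon> / 2"
        using \<epsilon> by (intro real_le_lsqrt) (auto intro: infsum_nonneg)
      then show ?thesis
        using \<epsilon> u commute[of "\<sigma> n" "J v"] by (simp add: hdist_J v_l2)
    qed
    then show "\<exists>N. \<forall>n\<ge>N. \<sigma> n \<in> carrier l2_space \<and> hdist (\<sigma> n) (J v) < \<epsilon>" by blast
  qed
  then show "\<exists>x. limitin mtopology \<sigma> x sequentially" by blast
qed

sublocale hilbert_space K l2_space l2_inner
  by (intro hilbert_space.intro l2_inner_product_space hilbert_space_axioms.intro l2_complete)

end

text \<open>A countable family of complex numbers is determined by the Dedekind cuts of its real and
  imaginary parts, which together form a subset of a countable set, and sets of naturals inject into the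
  reals.\<close>

lemma inj_coordinates_into_reals:
  obtains J :: "('i::countable \<Rightarrow> complex) \<Rightarrow> real" where "inj J"
proof -
  have "(UNIV :: nat set set) \<lesssim> (UNIV :: real set)" using nat_sets_eqpoll_reals by (rule eqpoll_imp_lepoll)
  then obtain E :: "nat set \<Rightarrow> real" where E: "inj E" unfolding lepoll_def by blast
  define cuts :: "('i \<Rightarrow> complex) \<Rightarrow> ('i \<times> bool \<times> rat) set" where
    "cuts x = {(i, b, q). of_rat q < (if b then Re (x i) else Im (x i))}" for x
  have "inj cuts"
  proof (rule injI)
    fix x y assume eq: "cuts x = cuts y"
    have real_eq: "r = s" if "\<And>q. of_rat q < r \<longleftrightarrow> of_rat q < s" for r s :: real
    proof (rule ccontr)
      assume "r \<noteq> s"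
      then consider "r < s" | "s < r" by linarith
      then show False
      proof cases
        case 1
        then obtain q where "r < of_rat q" "of_rat q < s" using of_rat_dense by blast
        then show False using that[of q] by simp
      next
        case 2
        then obtain q where "s < of_rat q" "of_rat q < r" using of_rat_dense by blast
        then show False using that[of q] by simp
      qed
    qed
    have "(i, b, q) \<in> cuts x \<longleftrightarrow> (i, b, q) \<in> cuts y" for i b q using eq by simp
    then have cut: "of_rat q < (if b then Re (x i) else Im (x i)) \<longleftrightarrow> of_rat q < (if b then Re (y i) else Im (y i))" for i b q
      by (simp add: cuts_def)
    have "Re (x i) = Re (y i)" "Im (x i) = Im (y i)" for i
      using real_eq[of "Re (x i)" "Re (y i)"] real_eq[of "Im (x i)" "Im (y i)"] cut[of _ True i] cut[of _ False i] by simp_all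
    then show "x = y" by (auto simp: complex_eq_iff)
  qed
  then have "inj (E \<circ> (\<lambda>A. to_nat ` A) \<circ> cuts)"
    using E by (intro inj_compose) (auto simp: inj_image_eq_iff intro!: injI)
  then show ?thesis by (rule that)
qed

context l2_copy
begin

definition real_vector :: "('i \<Rightarrow> real) \<Rightarrow> 'a" where
  "real_vector g = J (\<lambda>i. complex_of_real (g i))"

lemma real_vector_in_carrier:
  assumes "(\<lambda>i. (g i)\<^sup>2) summable_on UNIV"
  shows "real_vector g \<in> carrier l2_space"
  using assms by (auto simp: real_vector_def l2_vectors_def K_closed intro!: imageI)

lemma real_vector_finite_support:
  assumes "finite S" "\<And>i. i \<notin> S \<Longrightarrow> g i = 0"
  shows "real_vector g \<in> carrier l2_space"
proof (rule real_vector_in_carrier)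
  have "(\<lambda>i. (g i)\<^sup>2) summable_on S" using assms by simp
  then show "(\<lambda>i. (g i)\<^sup>2) summable_on UNIV"
    by (rule summable_on_cong_neutral[THEN iffD1, rotated -1]) (use assms in auto)
qed

lemma inner_real_vector:
  assumes "finite S" "\<And>i. i \<notin> S \<Longrightarrow> h i = 0"
  shows "l2_inner (real_vector g) (real_vector h) = complex_of_real (\<Sum>i\<in>S. g i * h i)"
proof -
  have "l2_inner (real_vector g) (real_vector h) = (\<Sum>\<^sub>\<infinity>i. complex_of_real (g i * h i))"
    by (simp add: l2_inner_def real_vector_def)
  also have "\<dots> = (\<Sum>\<^sub>\<infinity>i\<in>S. complex_of_real (g i * h i))"
    using assms by (intro infsum_cong_neutral) auto
  finally show ?thesis using assms by simp
qed

definition basis :: "'i \<Rightarrow> 'a" where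
  "basis i = real_vector (\<lambda>j. if j = i then 1 else 0)"

lemma basis_in_carrier: "basis i \<in> carrier l2_space"
  unfolding basis_def by (rule real_vector_finite_support[of "{i}"]) auto

lemma coord_basis: "coord (basis i) j = (if j = i then 1 else 0)"
  by (simp add: basis_def real_vector_def)

lemma inj_basis: "inj basis"
proof (rule injI)
  fix i j assume "basis i = basis j"
  then have "coord (basis i) i = coord (basis j) i" by simp
  then show "i = j" by (simp add: coord_basis split: if_splits)
qed

lemma hnorm_basis: "hnorm (basis i) = 1"
  unfolding hnorm_def basis_def by (subst inner_real_vector[of "{i}"]) auto

lemma finsum_basis:
  assumes "finite F" and u: "u \<in> l2_vectors K"
  shows "(\<Oplus>\<^bsub>l2_space\<^esub>g\<in>basis ` F. u (inv_into UNIV basis g) \<odot>\<^bsub>l2_space\<^esub> g) = J (\<lambda>i. if i \<in> F then u i else 0)"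
  using assms(1)
proof (induction F rule: finite_induct)
  case empty
  then show ?case by (simp only: image_empty M.finsum_empty) simp
next
  case (insert i F)
  have inside: "u (inv_into UNIV basis g) \<odot>\<^bsub>l2_space\<^esub> g \<in> carrier l2_space" if "g \<in> range basis" for g
    using that basis_in_carrier l2_D(1)[OF u] by (intro smult_in) auto
  have "basis i \<notin> basis ` F" using insert inj_basis by (auto simp: inj_image_mem_iff)
  then have "(\<Oplus>\<^bsub>l2_space\<^esub>g\<in>basis ` insert i F. u (inv_into UNIV basis g) \<odot>\<^bsub>l2_space\<^esub> g)
    = (u (inv_into UNIV basis (basis i)) \<odot>\<^bsub>l2_space\<^esub> basis i) \<oplus>\<^bsub>l2_space\<^esub> J (\<lambda>j. if j \<in> F then u j else 0)"
    unfolding image_insert insert.IH[symmetric] using insert inside by (intro M.finsum_insert) auto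
  also have "\<dots> = J (\<lambda>j. if j \<in> insert i F then u j else 0)"
    using insert inj_basis by (auto simp: coord_basis intro!: arg_cong[where f = J])
  finally show ?case .
qed

text \<open>Finite truncations are dense, so the coordinate vectors alone already span; further unit vectors
  can be added freely. This is why the vectors chosen by the algorithm may be put into the
  dictionary.\<close>

lemma dictionary_if_contains_basis:
  assumes D: "D \<subseteq> {g \<in> carrier l2_space. hnorm g = 1}" and basis: "range basis \<subseteq> D"
  shows "dictionary D"
  unfolding dictionary_def
proof (intro conjI D equalityI subsetI)
  show "x \<in> carrier l2_space" if "x \<in> mtopology closure_of lin_span D" for x
    using that unfolding metric_closure_of by blast
  fix x assume "x \<in> carrier l2_space"
  then obtain u where u: "u \<in> l2_vectors K" "x = J u" unfolding l2_space_simps by blast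
  have "\<exists>y\<in>lin_span D. y \<in> mball x \<epsilon>" if \<epsilon>: "0 < \<epsilon>" for \<epsilon>
  proof -
    have "0 < \<epsilon>\<^sup>2 / 2" using \<epsilon> by simp
    from infsum_finite_approximation[OF l2_D(2)[OF u(1)] this]
    obtain F where F: "finite F" "dist (\<Sum>i\<in>F. (cmod (u i))\<^sup>2) (\<Sum>\<^sub>\<infinity>i. (cmod (u i))\<^sup>2) \<le> \<epsilon>\<^sup>2 / 2" by blast
    define v where "v i = (if i \<in> F then u i else 0)" for i
    have y: "J v = (\<Oplus>\<^bsub>l2_space\<^esub>g\<in>basis ` F. u (inv_into UNIV basis g) \<odot>\<^bsub>l2_space\<^esub> g)"
      unfolding v_def by (rule finsum_basis[OF F(1) u(1), symmetric])
    have "J v \<in> lin_span D"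
      unfolding lin_span_def y using F(1) basis l2_D(1)[OF u(1)]
      by (intro CollectI exI[of _ "basis ` F"] exI[of _ "\<lambda>g. u (inv_into UNIV basis g)"]) auto
    moreover have v: "v \<in> l2_vectors K"
    proof -
      have "(\<lambda>i. (cmod (v i))\<^sup>2) summable_on F" using F by simp
      then have "(\<lambda>i. (cmod (v i))\<^sup>2) summable_on UNIV"
        by (rule summable_on_cong_neutral[THEN iffD1, rotated -1]) (auto simp: v_def)
      then show ?thesis using l2_D(1)[OF u(1)] K_closed by (auto simp: l2_vectors_def v_def)
    qed
    moreover have "hdist x (J v) < \<epsilon>"
    proof -
      have "(\<Sum>\<^sub>\<infinity>i. (cmod (u i))\<^sup>2) = (\<Sum>\<^sub>\<infinity>i. (cmod (u i - v i))\<^sup>2 + (cmod (v i))\<^sup>2)"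
        by (intro infsum_cong) (simp add: v_def)
      also have "\<dots> = (\<Sum>\<^sub>\<infinity>i. (cmod (u i - v i))\<^sup>2) + (\<Sum>\<^sub>\<infinity>i. (cmod (v i))\<^sup>2)"
        by (intro infsum_add l2_D l2_diff u v)
      also have "(\<Sum>\<^sub>\<infinity>i. (cmod (v i))\<^sup>2) = (\<Sum>\<^sub>\<infinity>i\<in>F. (cmod (u i))\<^sup>2)"
        by (intro infsum_cong_neutral) (auto simp: v_def)
      finally have "(\<Sum>\<^sub>\<infinity>i. (cmod (u i - v i))\<^sup>2) \<le> \<epsilon>\<^sup>2 / 2"
        using F by (simp add: dist_real_def)
      then have "(\<Sum>\<^sub>\<infinity>i. (cmod (u i - v i))\<^sup>2) < \<epsilon>\<^sup>2" using \<open>0 < \<epsilon>\<^sup>2 / 2\<close> by linarith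
      then have "sqrt (\<Sum>\<^sub>\<infinity>i. (cmod (u i - v i))\<^sup>2) < sqrt (\<epsilon>\<^sup>2)" by (rule real_sqrt_less_mono)
      then show ?thesis using \<epsilon> by (simp add: u hdist_J v)
    qed
    moreover have "J v \<in> carrier l2_space" using v by simp
    ultimately show ?thesis using \<open>x \<in> carrier l2_space\<close> unfolding in_mball by blast
  qed
  then show "x \<in> mtopology closure_of lin_span D"
    using \<open>x \<in> carrier l2_space\<close> unfolding metric_closure_of by blast
qed

end

section \<open>Geometry of an advancing front\<close>

text \<open>Coordinates of the front: for \<open>x\<close> between \<open>N\<close> and \<open>N + 1\<close>
  it is \<open>(1, \<dots>, 1, x - N, 0, \<dots>)\<close> with \<open>N\<close> ones. Letting
  \<open>x\<close> grow continuously rather than in unit jumps makes arbitrarily short advances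
  possible.\<close>

definition ramp :: "real \<Rightarrow> nat \<Rightarrow> real" where
  "ramp x i = max 0 (min 1 (x - real i))"

lemma ramp_nonneg: "0 \<le> ramp x i" and ramp_le_1: "ramp x i \<le> 1"
  and ramp_mono: "x \<le> y \<Longrightarrow> ramp x i \<le> ramp y i"
  and ramp_zero: "x \<le> real i \<Longrightarrow> ramp x i = 0"
  and ramp_one: "real i + 1 \<le> x \<Longrightarrow> ramp x i = 1"
  and ramp_diff_le: "x \<le> y \<Longrightarrow> ramp y i - ramp x i \<le> y - x"
  by (auto simp: ramp_def max_def min_def)

lemma sum_ramp:
  assumes "0 \<le> x"
  shows "(\<Sum>i<M. ramp x i) = min x (real M)"
proof (induction M)
  case (Suc M)
  then show ?case using assms by (auto simp: ramp_def max_def min_def)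
qed (use assms in simp)

definition ramp_prod :: "real \<Rightarrow> real \<Rightarrow> real" where
  "ramp_prod x y = (\<Sum>i<nat \<lceil>y\<rceil>. ramp x i * ramp y i)"

lemma ramp_prod_eq:
  assumes "y \<le> real M"
  shows "(\<Sum>i<M. ramp x i * ramp y i) = ramp_prod x y"
  unfolding ramp_prod_def
proof (rule sum.mono_neutral_right)
  show "{..<nat \<lceil>y\<rceil>} \<subseteq> {..<M}" using assms by (auto simp: nat_less_iff ceiling_le_iff[symmetric] intro: order_less_le_trans)
  show "\<forall>i\<in>{..<M} - {..<nat \<lceil>y\<rceil>}. ramp x i * ramp y i = 0"
  proof
    fix i assume "i \<in> {..<M} - {..<nat \<lceil>y\<rceil>}"
    then have "y \<le> real i" using real_nat_ceiling_ge[of y] by auto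
    then show "ramp x i * ramp y i = 0" by (simp add: ramp_zero)
  qed
qed simp

lemma ramp_prod_self_le: "0 \<le> x \<Longrightarrow> ramp_prod x x \<le> x"
proof -
  assume x: "0 \<le> x"
  have "ramp_prod x x \<le> (\<Sum>i<nat \<lceil>x\<rceil>. ramp x i)"
    unfolding ramp_prod_def by (intro sum_mono mult_left_le ramp_nonneg ramp_le_1)
  also have "\<dots> \<le> x" using sum_ramp[OF x] by simp
  finally show ?thesis .
qed

text \<open>There are at most \<open>x + 1\<close> nonzero coordinates and their sum is \<open>x\<close>, so
  Cauchy-Schwarz applies.\<close>

lemma ramp_prod_self_ge:
  assumes "1 \<le> x"
  shows "x / 2 \<le> ramp_prod x x"
proof -
  have ceil: "x \<le> real (nat \<lceil>x\<rceil>)" "real (nat \<lceil>x\<rceil>) \<le> 2 * x" using assms by linarith+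
  have "x\<^sup>2 = (\<Sum>i<nat \<lceil>x\<rceil>. ramp x i)\<^sup>2" using assms ceil sum_ramp[of x "nat \<lceil>x\<rceil>"] by (simp add: min_def)
  also have "\<dots> \<le> ramp_prod x x * real (nat \<lceil>x\<rceil>)"
    using sum_squared_le_sum_of_squares[of "ramp x" "{..<nat \<lceil>x\<rceil>}"] by (simp add: ramp_prod_def power2_eq_square)
  also have "\<dots> \<le> ramp_prod x x * (2 * x)"
    using ceil by (intro mult_left_mono) (auto simp: ramp_prod_def sum_nonneg ramp_nonneg)
  finally show ?thesis using assms by (simp add: power2_eq_square)
qed

text \<open>The coefficient of the orthogonal projection of \<open>ramp x\<close> onto the line of
  \<open>ramp y\<close>; the gap is the removed component and the loss its squared norm.\<close>

definition ramp_shrink :: "real \<Rightarrow> real \<Rightarrow> real" where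
  "ramp_shrink x y = ramp_prod x y / ramp_prod y y"

definition ramp_gap :: "real \<Rightarrow> real \<Rightarrow> nat \<Rightarrow> real" where
  "ramp_gap x y i = ramp x i - ramp_shrink x y * ramp y i"

definition ramp_loss :: "real \<Rightarrow> real \<Rightarrow> real" where
  "ramp_loss x y = (\<Sum>i<nat \<lceil>y\<rceil>. (ramp_gap x y i)\<^sup>2)"

lemma ramp_gap_zero: "x \<le> y \<Longrightarrow> y \<le> real i \<Longrightarrow> ramp_gap x y i = 0"
  by (simp add: ramp_gap_def ramp_zero)

context
  fixes x y :: real
  assumes xy: "8 \<le> x" "x \<le> y" "y \<le> x + 1"
begin

private abbreviation (input) "M \<equiv> nat \<lceil>y\<rceil>"
private abbreviation (input) "\<Delta> i \<equiv> ramp y i - ramp x i"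

private lemma M_ge: "y \<le> real M" "x \<le> real_of_int \<lceil>y\<rceil>" using xy by linarith+

lemma ramp_increment_sum: "(\<Sum>i<M. \<Delta> i) = y - x"
  using xy M_ge by (simp add: sum_subtractf sum_ramp min_def)

lemma ramp_increment_nonneg: "0 \<le> \<Delta> i" using xy by (simp add: ramp_mono)

lemma ramp_increment_sq_le: "(\<Sum>i<M. (\<Delta> i)\<^sup>2) \<le> (y - x)\<^sup>2"
proof -
  have "(\<Sum>i<M. (\<Delta> i)\<^sup>2) \<le> (\<Sum>i<M. \<Delta> i * (y - x))"
    unfolding power2_eq_square using xy by (intro sum_mono mult_left_mono ramp_diff_le ramp_increment_nonneg)
  also have "\<dots> = (\<Sum>i<M. \<Delta> i) * (y - x)" by (rule sum_distrib_right[symmetric])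
  finally show ?thesis by (simp add: ramp_increment_sum power2_eq_square)
qed

text \<open>An advance by at most one changes at most two coordinates, whose changes add up to \<open>y -
  x\<close>.\<close>

lemma ramp_increment_sq_ge: "(y - x)\<^sup>2 / 2 \<le> (\<Sum>i<M. (\<Delta> i)\<^sup>2)"
proof -
  define N where "N = nat \<lfloor>x\<rfloor>"
  have N: "real N \<le> x" "x < real N + 1" using xy unfolding N_def by linarith+
  have out: "\<Delta> i = 0" if "i \<notin> {N, Suc N}" for i
  proof (cases "i < N")
    case True
    then have "real i + 1 \<le> x" using N by linarith
    then show ?thesis using xy by (simp add: ramp_one)
  next
    case False
    then have "N + 2 \<le> i" using that by auto
    then have "y \<le> real i" using N xy by linarith
    then show ?thesis using xy by (simp add: ramp_zero)
  qed
  have "(y - x)\<^sup>2 = (\<Sum>i\<in>{..<M} \<inter> {N, Suc N}. \<Delta> i)\<^sup>2"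
    unfolding ramp_increment_sum[symmetric]
    by (rule arg_cong[where f = "\<lambda>z. z\<^sup>2"], rule sum.mono_neutral_right) (use out in auto)
  also have "\<dots> \<le> (\<Sum>i\<in>{..<M} \<inter> {N, Suc N}. (\<Delta> i)\<^sup>2) * card ({..<M} \<inter> {N, Suc N})"
    by (rule sum_squared_le_sum_of_squares)
  also have "\<dots> \<le> (\<Sum>i\<in>{..<M} \<inter> {N, Suc N}. (\<Delta> i)\<^sup>2) * 2"
  proof (rule mult_left_mono)
    have "card ({..<M} \<inter> {N, Suc N}) \<le> card {N, Suc N}" by (rule card_mono) auto
    then show "real (card ({..<M} \<inter> {N, Suc N})) \<le> 2" by simp
  qed (simp add: sum_nonneg)
  also have "\<dots> \<le> (\<Sum>i<M. (\<Delta> i)\<^sup>2) * 2"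
    by (intro mult_right_mono sum_mono2) auto
  finally show ?thesis by simp
qed

private abbreviation (input) "\<eta> \<equiv> (\<Sum>i<M. \<Delta> i * ramp y i)"

private lemma \<eta>_bounds: "0 \<le> \<eta>" "\<eta> \<le> y - x"
proof -
  show "0 \<le> \<eta>" by (intro sum_nonneg mult_nonneg_nonneg ramp_increment_nonneg ramp_nonneg)
  have "\<eta> \<le> (\<Sum>i<M. \<Delta> i)" by (intro sum_mono mult_left_le ramp_increment_nonneg ramp_le_1)
  then show "\<eta> \<le> y - x" by (simp add: ramp_increment_sum)
qed

lemma ramp_prod_self_pos: "4 \<le> ramp_prod y y" "y / 2 \<le> ramp_prod y y" "0 < ramp_prod y y"
  using ramp_prod_self_ge[of y] xy by auto

lemma ramp_prod_xy: "ramp_prod x y = ramp_prod y y - \<eta>"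
  by (simp add: ramp_prod_def left_diff_distrib sum_subtractf)

lemma ramp_shrink_eq: "1 - ramp_shrink x y = \<eta> / ramp_prod y y"
  using ramp_prod_self_pos by (simp add: ramp_shrink_def ramp_prod_xy field_simps)

lemma ramp_shrink_bounds: "0 < ramp_shrink x y" "ramp_shrink x y \<le> 1"
proof -
  have "0 \<le> \<eta> / ramp_prod y y" using \<eta>_bounds ramp_prod_self_pos by simp
  then show "ramp_shrink x y \<le> 1" using ramp_shrink_eq by linarith
  have "\<eta> < ramp_prod y y" using \<eta>_bounds ramp_prod_self_pos xy by linarith
  then show "0 < ramp_shrink x y" using ramp_prod_self_pos by (simp add: ramp_shrink_def ramp_prod_xy)
qed

lemma ramp_prod_xx: "ramp_prod x x = ramp_prod y y - 2 * \<eta> + (\<Sum>i<M. (\<Delta> i)\<^sup>2)"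
proof -
  have "ramp_prod x x = (\<Sum>i<M. ramp x i * ramp x i)" using M_ge xy by (intro ramp_prod_eq[symmetric]) simp
  also have "\<dots> = (\<Sum>i<M. ramp y i * ramp y i - 2 * (\<Delta> i * ramp y i) + (\<Delta> i)\<^sup>2)"
    by (intro sum.cong) (auto simp: power2_eq_square algebra_simps)
  also have "\<dots> = ramp_prod y y - 2 * \<eta> + (\<Sum>i<M. (\<Delta> i)\<^sup>2)"
    by (simp only: sum.distrib sum_subtractf sum_distrib_left[symmetric] ramp_prod_def)
  finally show ?thesis .
qed

lemma ramp_gap_orthogonal: "(\<Sum>i<M. ramp y i * ramp_gap x y i) = 0"
proof -
  have "(\<Sum>i<M. ramp y i * ramp_gap x y i) = ramp_prod x y - ramp_shrink x y * ramp_prod y y"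
    by (simp add: ramp_gap_def ramp_prod_def right_diff_distrib sum_subtractf sum_distrib_left mult_ac)
  then show ?thesis using ramp_prod_self_pos by (simp add: ramp_shrink_def)
qed

lemma ramp_gap_inner: "(\<Sum>i<M. ramp x i * ramp_gap x y i) = ramp_loss x y"
proof -
  have "ramp_loss x y = (\<Sum>i<M. ramp x i * ramp_gap x y i - ramp_shrink x y * (ramp y i * ramp_gap x y i))"
    unfolding ramp_loss_def
    by (intro sum.cong refl) (simp add: power2_eq_square ramp_gap_def algebra_simps)
  also have "\<dots> = (\<Sum>i<M. ramp x i * ramp_gap x y i)"
    by (simp add: sum_subtractf sum_distrib_left[symmetric] ramp_gap_orthogonal)
  finally show ?thesis by simp
qed

lemma ramp_loss_eq_diff: "ramp_loss x y = ramp_prod x x - (ramp_shrink x y)\<^sup>2 * ramp_prod y y"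
proof -
  have "ramp_loss x y = (\<Sum>i<M. ramp x i * ramp x i) - ramp_shrink x y * ramp_prod x y"
    unfolding ramp_gap_inner[symmetric]
    by (simp add: ramp_gap_def ramp_prod_def right_diff_distrib sum_subtractf sum_distrib_left mult_ac)
  also have "(\<Sum>i<M. ramp x i * ramp x i) = ramp_prod x x" using M_ge xy by (intro ramp_prod_eq) simp
  also have "ramp_shrink x y * ramp_prod x y = (ramp_shrink x y)\<^sup>2 * ramp_prod y y"
    using ramp_prod_self_pos by (simp add: ramp_shrink_def power2_eq_square)
  finally show ?thesis .
qed

lemma ramp_loss_eq: "ramp_loss x y = (\<Sum>i<M. (\<Delta> i)\<^sup>2) - \<eta>\<^sup>2 / ramp_prod y y"
proof -
  have square: "(1 - e / Q)\<^sup>2 * Q = Q - 2 * e + e\<^sup>2 / Q" if "0 < Q" for e Q :: real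
    using that by (simp add: power2_eq_square field_simps)
  have "ramp_shrink x y = 1 - \<eta> / ramp_prod y y" using ramp_shrink_eq by simp
  then show ?thesis
    unfolding ramp_loss_eq_diff ramp_prod_xx
    using square[OF ramp_prod_self_pos(3), of \<eta>] by simp
qed

lemma ramp_loss_le: "ramp_loss x y \<le> (y - x)\<^sup>2"
proof -
  have "0 \<le> \<eta>\<^sup>2 / ramp_prod y y" using ramp_prod_self_pos by simp
  then show ?thesis using ramp_increment_sq_le by (simp add: ramp_loss_eq)
qed

text \<open>The increment has squared norm at least \<open>(y - x) ^ 2 / 2\<close>, and at most half of it
  lies along \<open>ramp y\<close>, because \<open>ramp_prod y y \<ge> 4\<close>. This is where the starting
  width 8 comes from.\<close>

lemma ramp_loss_ge: "(y - x)\<^sup>2 / 4 \<le> ramp_loss x y"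
proof -
  have "\<eta>\<^sup>2 \<le> (y - x)\<^sup>2" using \<eta>_bounds by (intro power_mono) auto
  then have "\<eta>\<^sup>2 / ramp_prod y y \<le> (y - x)\<^sup>2 / 4"
    using ramp_prod_self_pos by (intro frac_le) auto
  then show ?thesis using ramp_increment_sq_ge by (simp add: ramp_loss_eq)
qed

lemma ramp_loss_le_relative: "ramp_loss x y \<le> ramp_prod x x * (2 * (y - x)\<^sup>2 / x)"
proof -
  have "(y - x)\<^sup>2 = x / 2 * (2 * (y - x)\<^sup>2 / x)" using xy by simp
  also have "\<dots> \<le> ramp_prod x x * (2 * (y - x)\<^sup>2 / x)"
    using ramp_prod_self_ge[of x] xy by (intro mult_right_mono) auto
  finally show ?thesis using ramp_loss_le by linarith
qed

text \<open>The decisive estimate. The gap is a short vector concentrated on the moving coordinates, minus a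
  small multiple of \<open>ramp y\<close>; the sum of its absolute values is of the same order \<open>y -
  x\<close> as its Euclidean norm, and all coordinates of \<open>ramp z\<close> are at most 1. Hence the
  unit vector in the direction of any advance, past or future, has bounded inner product with every front,
  although the norm of \<open>ramp z\<close> is about \<open>sqrt z\<close>.\<close>

lemma ramp_gap_inner_bound:
  "\<bar>\<Sum>i<M. ramp z i * ramp_gap x y i\<bar> \<le> 4 * sqrt (ramp_loss x y)"
proof -
  define P where "P = (\<Sum>i<M. ramp z i * ramp y i)"
  define R where "R = (\<Sum>i<M. ramp z i * \<Delta> i)"
  have eq: "(\<Sum>i<M. ramp z i * ramp_gap x y i) = \<eta> / ramp_prod y y * P - R"
  proof -
    have "ramp z i * ramp_gap x y i = (1 - ramp_shrink x y) * (ramp z i * ramp y i) - ramp z i * \<Delta> i" for i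
      by (simp add: ramp_gap_def algebra_simps)
    then show ?thesis
      by (simp only: sum_subtractf sum_distrib_left[symmetric] P_def R_def ramp_shrink_eq)
  qed
  have R: "0 \<le> R" "R \<le> y - x"
  proof -
    show "0 \<le> R" unfolding R_def by (intro sum_nonneg mult_nonneg_nonneg ramp_increment_nonneg ramp_nonneg)
    have "R \<le> (\<Sum>i<M. \<Delta> i)"
      unfolding R_def by (intro sum_mono mult_left_le_one_le ramp_increment_nonneg ramp_le_1 ramp_nonneg)
    then show "R \<le> y - x" by (simp add: ramp_increment_sum)
  qed
  have P: "0 \<le> P" "P \<le> y"
  proof -
    show "0 \<le> P" unfolding P_def by (intro sum_nonneg mult_nonneg_nonneg ramp_nonneg)
    have "P \<le> (\<Sum>i<M. ramp y i)"
      unfolding P_def by (intro sum_mono mult_left_le_one_le ramp_le_1 ramp_nonneg)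
    then show "P \<le> y" using xy by (simp add: sum_ramp)
  qed
  have "\<eta> / ramp_prod y y * P \<le> (y - x) / ramp_prod y y * y"
    using \<eta>_bounds P ramp_prod_self_pos xy by (intro mult_mono divide_right_mono) auto
  also have "\<dots> = (y - x) * (y / ramp_prod y y)" by simp
  also have "\<dots> \<le> (y - x) * 2"
    using ramp_prod_self_pos xy by (intro mult_left_mono) (auto simp: field_simps)
  finally have 1: "\<eta> / ramp_prod y y * P \<le> 2 * (y - x)" by simp
  have 0: "0 \<le> \<eta> / ramp_prod y y * P" using \<eta>_bounds P ramp_prod_self_pos by simp
  have "\<bar>\<Sum>i<M. ramp z i * ramp_gap x y i\<bar> \<le> 2 * (y - x)"
    unfolding eq using 0 1 R xy by (simp add: abs_le_iff)
  also have "y - x = 2 * sqrt ((y - x)\<^sup>2 / 4)" using xy by (simp add: real_sqrt_divide)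
  also have "2 * (2 * sqrt ((y - x)\<^sup>2 / 4)) \<le> 4 * sqrt (ramp_loss x y)" using ramp_loss_ge by simp
  finally show ?thesis .
qed

end

section \<open>A schedule for the moving front\<close>

text \<open>A summable sequence may drop to almost nothing and jump up again one step later; the schedule
  needs the speed of the front in a block to be comparable with the speed in the block before. The majorant
  \<open>\<sigma> n = \<Sum>i. y (n + i) / 2 ^ i\<close> anticipates coming large values and so at most
  doubles from one index to the next.\<close>

lemma summable_regular_majorant:
  fixes y :: "nat \<Rightarrow> real"
  assumes y: "\<And>n. 0 < y n" "\<And>n. y n \<le> M" and sm: "summable y"
  obtains \<sigma> where "summable \<sigma>" "\<And>n. y n \<le> \<sigma> n" "\<And>n. \<sigma> n \<le> 2 * M" "\<And>n. \<sigma> (Suc n) \<le> 2 * \<sigma> n"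
proof
  define \<sigma> where "\<sigma> n = (\<Sum>i. (1 / 2) ^ i * y (n + i))" for n
  have geo: "(\<lambda>i. (1 / 2) ^ i * M) sums (2 * M)"
    using sums_mult2[OF geometric_sums[of "1 / 2 :: real"], of M] by simp
  have sm\<sigma>: "summable (\<lambda>i. (1 / 2) ^ i * y (n + i))" for n
    by (rule summable_comparison_test'[OF sums_summable[OF geo], where N = 0])
      (use y in \<open>auto simp: abs_mult less_imp_le\<close>)
  have \<sigma>_nonneg: "0 \<le> \<sigma> n" for n
    unfolding \<sigma>_def using y by (intro suminf_nonneg sm\<sigma>) (auto simp: less_imp_le)
  have rec: "\<sigma> n = y n + \<sigma> (Suc n) / 2" for n
    using suminf_split_head[OF sm\<sigma>[of n]] suminf_divide[OF sm\<sigma>[of "Suc n"], of 2]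
    by (simp add: \<sigma>_def)
  show "y n \<le> \<sigma> n" for n using rec[of n] \<sigma>_nonneg[of "Suc n"] by simp
  show "\<sigma> (Suc n) \<le> 2 * \<sigma> n" for n using rec[of n] y(1)[of n] by simp
  show \<sigma>_le: "\<sigma> n \<le> 2 * M" for n
    unfolding \<sigma>_def sums_unique[OF geo]
    using y by (intro suminf_le sm\<sigma> sums_summable[OF geo]) (auto intro: mult_left_mono)
  show "summable \<sigma>"
  proof (rule summable_nonneg_bounded)
    fix n
    have "sum \<sigma> {..<n} = (\<Sum>i<n. y i + \<sigma> (Suc i) / 2)" by (intro sum.cong refl rec)
    also have "\<dots> = sum y {..<n} + (\<Sum>i<n. \<sigma> (Suc i)) / 2" by (simp add: sum.distrib sum_divide_distrib)
    also have "(\<Sum>i<n. \<sigma> (Suc i)) = sum \<sigma> {..<Suc n} - \<sigma> 0" by (simp add: sum.lessThan_Suc_shift del: sum.lessThan_Suc)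
    also have "\<dots> \<le> sum \<sigma> {..<n} + 2 * M" using \<sigma>_nonneg[of 0] \<sigma>_le[of n] by simp
    finally have "sum \<sigma> {..<n} \<le> sum y {..<n} + (sum \<sigma> {..<n} + 2 * M) / 2" by simp
    moreover have "sum y {..<n} \<le> suminf y" using y by (intro sum_le_suminf sm) (auto simp: less_imp_le)
    ultimately show "sum \<sigma> {..<n} \<le> 2 * suminf y + 2 * M" by (simp add: field_simps)
  qed (rule \<sigma>_nonneg)
qed

context
  fixes t :: "nat \<Rightarrow> real"
  assumes t: "\<And>j. j \<ge> 1 \<Longrightarrow> 0 \<le> t j \<and> t j \<le> 1"
begin

lemma block_rms_le_1: "block_rms t n \<le> 1"
proof -
  have "(\<Sum>k\<in>dyadic_block n. (t k)\<^sup>2) \<le> (\<Sum>k\<in>dyadic_block n. 1)"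
  proof (rule sum_mono)
    fix k assume "k \<in> dyadic_block n"
    then have "0 < k" by (auto simp: dyadic_block_eq intro!: gr0I)
    then show "(t k)\<^sup>2 \<le> 1" using t[of k] by (simp add: power_le_one)
  qed
  then show ?thesis by (simp add: block_rms_def)
qed

text \<open>In block \<open>n\<close> the front moves with speed about \<open>\<sigma> n\<close>, a regular
  majorant of \<open>block_rms t n\<close>, so that after block \<open>n - 1\<close> the width is at least a
  multiple of \<open>2 ^ n \<sigma> n\<close>. Block \<open>n\<close> then contributes at most a multiple of
  \<open>2 ^ n (\<sigma> n) ^ 2 / (2 ^ n \<sigma> n) = \<sigma> n\<close> to the two sums. The front rests
  whenever \<open>t k\<close> is large; the last factor in the definition of \<open>s\<close> achieves this
  and, in late blocks, costs at most half of the distance, as the mean of \<open>t k ^ 2\<close> over a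
  block tends to zero.\<close>

lemma spreading_schedule_exists:
  assumes sm: "summable (block_rms t)"
  obtains s :: "nat \<Rightarrow> real" where
    "\<And>n. 0 \<le> s n" "\<And>n. s n \<le> 1" "\<And>n. 0 < s n \<Longrightarrow> t n \<le> 1 / 2" "\<And>n. 1 \<le> n \<Longrightarrow> 0 < s n \<or> 0 < t n"
    "summable (\<lambda>m. ((s (m + 1))\<^sup>2 + (t (m + 1))\<^sup>2) / (8 + sum s {1..m}))"
proof -
  obtain \<sigma> where \<sigma>: "summable \<sigma>" "\<And>n. block_rms t n + (1 / 2) ^ n \<le> \<sigma> n" "\<And>n. \<sigma> n \<le> 2 * 2"
      "\<And>n. \<sigma> (Suc n) \<le> 2 * \<sigma> n"
  proof (rule summable_regular_majorant)
    \<comment> \<open>The geometric term keeps the speed of the front positive even where \<open>t\<close> vanishes.\<close>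
    show "summable (\<lambda>n. block_rms t n + (1 / 2) ^ n)"
      by (intro summable_add sm summable_geometric) auto
    show "block_rms t n + (1 / 2) ^ n \<le> 2" for n
      using block_rms_le_1[of n] power_le_one[of "1/2::real" n] by simp
    show "0 < block_rms t n + (1 / 2) ^ n" for n
      using block_rms_nonneg[of t n] by (simp add: add_nonneg_pos)
  qed blast
  have \<sigma>_pos: "0 < \<sigma> n" for n
    using \<sigma>(2)[of n] block_rms_nonneg[of t n] zero_less_power[of "1/2::real" n] by linarith
  have rms_le: "block_rms t n \<le> \<sigma> n" for n
    using \<sigma>(2)[of n] zero_less_power[of "1/2::real" n] by linarith
  define ix where "ix k = (LEAST n. k < (2::nat) ^ Suc n)" for k
  have ix: "ix k = n" if "k \<in> dyadic_block n" for k n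
    unfolding ix_def
  proof (rule Least_equality)
    show "k < 2 ^ Suc n" using that by (simp add: dyadic_block_eq)
    fix m assume "k < 2 ^ Suc m"
    moreover have "2 ^ n \<le> k" using that by (simp add: dyadic_block_eq)
    ultimately have "(2::nat) ^ n < 2 ^ Suc m" by (rule order_le_less_trans[rotated])
    then show "n \<le> m" by (simp only: power_strict_increasing_iff)
  qed
  \<comment> \<open>The factor 1/4 brings the speed below 1, as \<open>\<sigma> \<le> 4\<close>; for \<open>k \<ge> 1\<close> the last factor vanishes when \<open>t k \<ge> 1 / 2\<close>.\<close>
  define s where "s k = \<sigma> (ix k) / 4 * max 0 (1 - 4 * (t k)\<^sup>2)" for k
  have s_nonneg: "0 \<le> s k" for k using \<sigma>_pos[of "ix k"] by (simp add: s_def)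
  have s_le: "s k \<le> \<sigma> (ix k) / 4" for k
    unfolding s_def using \<sigma>_pos[of "ix k"] mult_left_mono[of "max 0 (1 - 4 * (t k)\<^sup>2)" 1 "\<sigma> (ix k) / 4"] by simp
  have s_ge: "\<sigma> (ix k) / 4 * (1 - 4 * (t k)\<^sup>2) \<le> s k" for k
    unfolding s_def using \<sigma>_pos[of "ix k"] by (intro mult_left_mono) auto
  define x where "x m = 8 + sum s {1..m}" for m
  have x_ge: "8 \<le> x m" for m using s_nonneg by (simp add: x_def sum_nonneg)
  define cost where "cost k = ((s k)\<^sup>2 + (t k)\<^sup>2) / x (k - 1)" for k
  have cost_nonneg: "0 \<le> cost k" for k using x_ge[of "k - 1"] by (simp add: cost_def)
  have "\<forall>\<^sub>F n in sequentially. (block_rms t n)\<^sup>2 \<le> 1 / 8"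
  proof -
    have "(\<lambda>n. (block_rms t n)\<^sup>2) \<longlonglongrightarrow> 0\<^sup>2" by (intro tendsto_intros summable_LIMSEQ_zero sm)
    then have "\<forall>\<^sub>F n in sequentially. (block_rms t n)\<^sup>2 < 1 / 8" by (rule order_tendstoD) simp
    then show ?thesis by eventually_elim simp
  qed
  then obtain n0 where n0: "\<And>n. n0 \<le> n \<Longrightarrow> (block_rms t n)\<^sup>2 \<le> 1 / 8"
    by (auto simp: eventually_sequentially)
  have block: "sum cost (dyadic_block n) \<le> 64 * \<sigma> n" if "Suc n0 \<le> n" for n
  proof -
    obtain l where l: "n = Suc l" "n0 \<le> l" using \<open>Suc n0 \<le> n\<close> by (cases n) auto
    have low: "2 ^ n * \<sigma> n / 32 \<le> x (k - 1)" if k: "k \<in> dyadic_block n" for k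
    proof -
      have "2 ^ n * \<sigma> n / 32 \<le> 2 ^ l * \<sigma> l / 8" using \<sigma>(4)[of l] l by simp
      also have "\<dots> \<le> \<sigma> l / 4 * 2 ^ l * (1 - 4 * (block_rms t l)\<^sup>2)"
      proof -
        have "1 / 2 \<le> 1 - 4 * (block_rms t l)\<^sup>2" using n0[OF l(2)] by simp
        from mult_left_mono[OF this, of "\<sigma> l / 4 * 2 ^ l"] show ?thesis using \<sigma>_pos[of l] by simp
      qed
      also have "\<dots> = (\<Sum>j\<in>dyadic_block l. \<sigma> l / 4 * (1 - 4 * (t j)\<^sup>2))"
        by (simp add: sum_distrib_left[symmetric] sum_subtractf block_rms_sq[of t l] del: times_divide_eq_left)
          (simp add: algebra_simps)
      also have "\<dots> \<le> sum s (dyadic_block l)"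
        using s_ge ix by (intro sum_mono) force
      also have "\<dots> \<le> sum s {1..k - 1}"
      proof (rule sum_mono2)
        have "2 ^ l \<ge> (1::nat)" by simp
        then show "dyadic_block l \<subseteq> {1..k - 1}"
          using k l(1) by (auto simp: dyadic_block_eq simp del: one_le_power one_le_numeral)
      qed (use s_nonneg in auto)
      finally show ?thesis by (simp add: x_def)
    qed
    have "cost k \<le> ((\<sigma> n)\<^sup>2 / 16 + (t k)\<^sup>2) / (2 ^ n * \<sigma> n / 32)" if k: "k \<in> dyadic_block n" for k
      unfolding cost_def
    proof (rule frac_le)
      have "(s k)\<^sup>2 \<le> (\<sigma> n / 4)\<^sup>2" using s_le[of k] ix[OF k] s_nonneg by (intro power_mono) auto
      then show "(s k)\<^sup>2 + (t k)\<^sup>2 \<le> (\<sigma> n)\<^sup>2 / 16 + (t k)\<^sup>2" by (simp add: power_divide)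
    qed (use low[OF k] \<sigma>_pos in auto)
    then have "sum cost (dyadic_block n) \<le> (\<Sum>k\<in>dyadic_block n. ((\<sigma> n)\<^sup>2 / 16 + (t k)\<^sup>2) / (2 ^ n * \<sigma> n / 32))"
      by (rule sum_mono)
    also have "\<dots> = (2 ^ n * (\<sigma> n)\<^sup>2 / 16 + 2 ^ n * (block_rms t n)\<^sup>2) / (2 ^ n * \<sigma> n / 32)"
      by (simp only: sum_divide_distrib[symmetric] sum.distrib block_rms_sq[of t n]) simp
    also have "\<dots> \<le> (2 ^ n * (\<sigma> n)\<^sup>2 / 16 + 2 ^ n * (\<sigma> n)\<^sup>2) / (2 ^ n * \<sigma> n / 32)"
      using rms_le[of n] block_rms_nonneg[of t n] \<sigma>_pos[of n]
      by (intro divide_right_mono add_left_mono mult_left_mono power_mono) auto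
    also have "\<dots> = 34 * \<sigma> n" using \<sigma>_pos[of n] by (simp add: power2_eq_square field_simps)
    also have "\<dots> \<le> 64 * \<sigma> n" using \<sigma>_pos[of n] by simp
    finally show ?thesis .
  qed
  have "summable (\<lambda>n. sum cost (dyadic_block n))"
    by (rule summable_comparison_test'[OF summable_mult[OF \<sigma>(1), of 64], where N = "Suc n0"])
      (use block cost_nonneg in \<open>auto simp: sum_nonneg\<close>)
  then have sm_cost: "summable (\<lambda>m. cost (m + 1))"
    using cost_nonneg by (subst summable_iff_dyadic_block_sums) auto
  show ?thesis
  proof
    show "0 \<le> s n" for n by (rule s_nonneg)
    show "s n \<le> 1" for n using s_le[of n] \<sigma>(3)[of "ix n"] by simp
    show "t n \<le> 1 / 2" if "0 < s n" for n
    proof -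
      have "0 < 1 - 4 * (t n)\<^sup>2" using that \<sigma>_pos[of "ix n"] by (auto simp: s_def max_def zero_less_mult_iff split: if_splits)
      then have "(t n)\<^sup>2 \<le> (1 / 2)\<^sup>2" by (simp add: power2_eq_square)
      then show ?thesis by (rule power2_le_imp_le) simp
    qed
    show "0 < s n \<or> 0 < t n" if "1 \<le> n" for n
      using t[OF that] \<sigma>_pos[of "ix n"] by (cases "t n = 0") (auto simp: s_def)
    show "summable (\<lambda>m. ((s (m + 1))\<^sup>2 + (t (m + 1))\<^sup>2) / (8 + sum s {1..m}))"
      using sm_cost by (simp add: cost_def x_def)
  qed
qed

end

section \<open>A greedy run with residuals bounded away from zero\<close>

text \<open>Fronts advance only when \<open>t n \<le> 1 / 2\<close>: a step with weakness close to 1 must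
  choose an almost optimal dictionary element, which leaves no room for a moving component. The condition
  \<open>active\<close> makes every chosen direction nonzero.\<close>

locale spreading_schedule =
  fixes t s :: "nat \<Rightarrow> real"
  assumes t: "\<And>j. j \<ge> 1 \<Longrightarrow> 0 \<le> t j \<and> t j \<le> 1"
    and s_nonneg: "\<And>n. 0 \<le> s n" and s_le_1: "\<And>n. s n \<le> 1"
    and moving: "\<And>n. 0 < s n \<Longrightarrow> t n \<le> 1 / 2"
    and active: "\<And>n. 1 \<le> n \<Longrightarrow> 0 < s n \<or> 0 < t n"
    and cheap: "summable (\<lambda>m. ((s (m + 1))\<^sup>2 + (t (m + 1))\<^sup>2) / (8 + sum s {1..m}))"
begin

definition width :: "nat \<Rightarrow> real" where "width n = 8 + sum s {1..n}"

lemma width_ge: "8 \<le> width n" using s_nonneg by (simp add: width_def sum_nonneg)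
lemma width_Suc: "width (Suc n) = width n + s (Suc n)" by (simp add: width_def)
lemma width_step: "8 \<le> width n" "width n \<le> width (Suc n)" "width (Suc n) \<le> width n + 1"
  using width_ge s_nonneg[of "Suc n"] s_le_1[of "Suc n"] by (auto simp: width_Suc)

text \<open>The height is forced: the new front must be the orthogonal projection of the old one.\<close>

primrec height :: "nat \<Rightarrow> real" where
  "height 0 = 1"
| "height (Suc n) = height n * ramp_shrink (width n) (width (Suc n))"

lemma height_pos: "0 < height n"
  using ramp_shrink_bounds[OF width_step] by (induction n) auto

lemma height_antimono: "m \<le> n \<Longrightarrow> height n \<le> height m"
proof (rule lift_Suc_antimono_le[of height])
  show "height (Suc k) \<le> height k" for k
    using ramp_shrink_bounds[OF width_step, of k] height_pos[of k] by (simp add: mult_left_le)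
qed

text \<open>The squared norm of the front part of the residual.\<close>

definition mass :: "nat \<Rightarrow> real" where "mass n = (height n)\<^sup>2 * ramp_prod (width n) (width n)"

text \<open>The part of the squared norm that the advance at step \<open>n\<close> removes from the
  front.\<close>

definition drift :: "nat \<Rightarrow> real" where
  "drift n = (height (n - 1))\<^sup>2 * ramp_loss (width (n - 1)) (width n)"

definition loss_rate :: "nat \<Rightarrow> real" where "loss_rate n = 2 * (s (Suc n))\<^sup>2 / width n"

lemma drift_nonneg: "0 \<le> drift n" by (simp add: drift_def ramp_loss_def sum_nonneg)

lemma mass_Suc: "mass (Suc n) = mass n - drift (Suc n)"
  using ramp_loss_eq_diff[OF width_step, of n]
  by (simp add: mass_def drift_def power_mult_distrib right_diff_distrib mult.assoc)

lemma mass_pos: "0 < mass n"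
  using height_pos[of n] ramp_prod_self_ge[of "width n"] width_ge[of n] by (simp add: mass_def)

lemma drift_le: "drift (Suc n) \<le> mass n * loss_rate n"
proof -
  have "ramp_loss (width n) (width (Suc n)) \<le> ramp_prod (width n) (width n) * loss_rate n"
    using ramp_loss_le_relative[OF width_step, of n] by (simp add: loss_rate_def width_Suc)
  from mult_left_mono[OF this, of "(height n)\<^sup>2"] show ?thesis by (simp add: drift_def mass_def mult.assoc)
qed

lemma loss_rate_bounds: "0 \<le> loss_rate n" "loss_rate n \<le> 1"
proof -
  show "0 \<le> loss_rate n" using width_ge[of n] by (simp add: loss_rate_def)
  have "(s (Suc n))\<^sup>2 \<le> 1" using s_nonneg s_le_1 by (simp add: power_le_one)
  then show "loss_rate n \<le> 1" using width_ge[of n] by (simp add: loss_rate_def)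
qed

lemma summable_loss_rate: "summable loss_rate"
proof (rule summable_comparison_test'[OF summable_mult[OF cheap, of 2], where N = 0])
  show "norm (loss_rate n) \<le> 2 * (((s (n + 1))\<^sup>2 + (t (n + 1))\<^sup>2) / (8 + sum s {1..n}))" for n
    unfolding width_def[symmetric] using loss_rate_bounds(1)[of n] width_ge[of n]
    by (simp add: loss_rate_def divide_right_mono)
qed

text \<open>Each step multiplies the mass by at least \<open>1 - loss_rate\<close>. From the point on where
  the remaining rates sum to at most one half, the product of these factors stays above one half.\<close>

lemma mass_bounded_below: "\<exists>\<rho>>0. \<forall>\<^sub>F n in sequentially. \<rho> \<le> mass n"
proof -
  obtain N where N: "\<And>k. (\<Sum>j<k. loss_rate (N + j)) \<le> 1 / 2"
  proof -
    have "(\<lambda>n. \<Sum>j. loss_rate (j + n)) \<longlonglongrightarrow> 0" by (rule suminf_exist_split2[OF summable_loss_rate])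
    then have "\<forall>\<^sub>F n in sequentially. (\<Sum>j. loss_rate (j + n)) < 1 / 2" by (rule order_tendstoD) simp
    then obtain N where a: "(\<Sum>j. loss_rate (j + N)) < 1 / 2" by (auto simp: eventually_sequentially)
    have b: "(\<Sum>j<k. loss_rate (j + N)) \<le> (\<Sum>j. loss_rate (j + N))" for k
      using loss_rate_bounds summable_loss_rate by (intro sum_le_suminf summable_ignore_initial_segment) auto
    have "(\<Sum>j<k. loss_rate (N + j)) \<le> 1 / 2" for k
      using a b[of k] unfolding add.commute[of N] by linarith
    then show ?thesis by (rule that)
  qed
  have "mass N * (1 - (\<Sum>j<k. loss_rate (N + j))) \<le> mass (N + k)" for k
  proof (induction k)
    case (Suc k)
    define S where "S = (\<Sum>j<k. loss_rate (N + j))"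
    define r where "r = loss_rate (N + k)"
    have S: "0 \<le> S" and r: "0 \<le> r" "r \<le> 1" using loss_rate_bounds by (auto simp: S_def r_def sum_nonneg)
    have "mass N * (1 - (S + r)) \<le> mass N * ((1 - S) * (1 - r))"
      using S r mass_pos[of N] by (intro mult_left_mono) (auto simp: algebra_simps)
    also have "\<dots> \<le> mass (N + k) * (1 - r)"
      using mult_right_mono[OF Suc.IH, of "1 - r"] r by (simp add: S_def mult.assoc)
    also have "\<dots> \<le> mass (Suc (N + k))"
      using drift_le[of "N + k"] by (simp add: mass_Suc r_def right_diff_distrib)
    finally show ?case by (simp add: S_def r_def)
  qed simp
  moreover have "mass N / 2 \<le> mass N * (1 - (\<Sum>j<k. loss_rate (N + j)))" for k
    using mult_left_mono[of "1 / 2" "1 - (\<Sum>j<k. loss_rate (N + j))" "mass N"] N[of k] mass_pos[of N] by simp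
  ultimately have "mass N / 2 \<le> mass (N + k)" for k by (meson order_trans)
  then have "\<forall>n\<ge>N. mass N / 2 \<le> mass n" by (metis le_add_diff_inverse)
  then show ?thesis using mass_pos[of N] by (intro exI[of _ "mass N / 2"]) (auto simp: eventually_sequentially)
qed

text \<open>The coefficient of the fresh direction reserved for step \<open>n\<close>. Inner products of the
  residual with the dictionary will be bounded by \<open>8 * height (n - 1)\<close> before this step, hence
  the choice of the value.\<close>

definition stock :: "nat \<Rightarrow> real" where "stock n = 8 * t n * height (n - 1)"

lemma stock_nonneg: "1 \<le> n \<Longrightarrow> 0 \<le> stock n"
  using t height_pos[of "n - 1"] by (simp add: stock_def)

lemma summable_stock: "summable (\<lambda>n. (stock (Suc n))\<^sup>2)"
proof (rule summable_comparison_test'[OF summable_mult[OF cheap, of 1024], where N = 0])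
  fix n
  have mass_le: "mass k \<le> 8" for k
  proof (induction k)
    case 0
    then show ?case using ramp_prod_self_le[of 8] by (simp add: mass_def width_def)
  next
    case (Suc k)
    then show ?case using drift_nonneg[of "Suc k"] by (simp add: mass_Suc)
  qed
  have "(height n)\<^sup>2 * (width n / 2) \<le> mass n"
    unfolding mass_def using ramp_prod_self_ge[of "width n"] width_ge[of n] by (intro mult_left_mono) auto
  then have "(height n)\<^sup>2 \<le> 16 / width n" using mass_le[of n] width_ge[of n] by (simp add: field_simps)
  \<comment> \<open>The constant 1024 is \<open>8 ^ 2\<close> from the stock times 16 from the height.\<close>
  then have "64 * (t (Suc n))\<^sup>2 * (height n)\<^sup>2 \<le> 64 * (t (Suc n))\<^sup>2 * (16 / width n)"
    by (intro mult_left_mono) auto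
  also have "\<dots> = 1024 * ((t (Suc n))\<^sup>2 / width n)" by simp
  also have "\<dots> \<le> 1024 * (((s (Suc n))\<^sup>2 + (t (Suc n))\<^sup>2) / width n)"
    using width_ge[of n] by (intro mult_left_mono divide_right_mono) auto
  finally show "norm ((stock (Suc n))\<^sup>2) \<le> 1024 * (((s (n + 1))\<^sup>2 + (t (n + 1))\<^sup>2) / (8 + sum s {1..n}))"
    by (simp add: stock_def power_mult_distrib width_def)
qed

definition step :: "nat \<Rightarrow> real" where "step n = sqrt (drift n + (stock n)\<^sup>2)"

lemma step_sq: "(step n)\<^sup>2 = drift n + (stock n)\<^sup>2"
  by (simp add: step_def drift_nonneg)

lemma stock_le_step: "stock n \<le> step n"
  unfolding step_def by (rule real_le_rsqrt) (simp add: drift_nonneg)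

lemma sqrt_drift_le_step: "sqrt (drift n) \<le> step n"
  unfolding step_def by simp

lemma step_pos: "1 \<le> n \<Longrightarrow> 0 < step n"
proof -
  assume n: "1 \<le> n"
  then obtain m where m: "n = Suc m" by (cases n) auto
  from active[OF n] have "0 < drift n + (stock n)\<^sup>2"
  proof
    assume "0 < s n"
    then have "0 < (width n - width m)\<^sup>2 / 4" by (simp add: m width_Suc)
    also have "\<dots> \<le> ramp_loss (width m) (width n)" unfolding m by (rule ramp_loss_ge[OF width_step])
    finally have "0 < drift n" using height_pos[of m] by (simp add: drift_def m)
    then show ?thesis by (simp add: add_pos_nonneg)
  next
    assume "0 < t n"
    then have "0 < stock n" using height_pos by (simp add: stock_def)
    then show ?thesis using drift_nonneg by (simp add: add_nonneg_pos)
  qed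
  then show "0 < step n" by (simp add: step_def)
qed

text \<open>Left coordinates carry the front, right coordinates the stock that has not been used
  yet.\<close>

definition residual_coords :: "nat \<Rightarrow> nat + nat \<Rightarrow> real" where
  "residual_coords n = case_sum (\<lambda>i. height n * ramp (width n) i) (\<lambda>k. if n < k then stock k else 0)"

definition choice_coords :: "nat \<Rightarrow> nat + nat \<Rightarrow> real" where
  "choice_coords m = case_sum (\<lambda>i. height (m - 1) * ramp_gap (width (m - 1)) (width m) i / step m)
     (\<lambda>k. if k = m then stock m / step m else 0)"

definition choice_support :: "nat \<Rightarrow> (nat + nat) set" where
  "choice_support m = Inl ` {..<nat \<lceil>width m\<rceil>} \<union> Inr ` {m}"

lemma finite_choice_support: "finite (choice_support m)" by (simp add: choice_support_def)

lemma choice_coords_outside: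
  assumes m: "1 \<le> m" and j: "j \<notin> choice_support m"
  shows "choice_coords m j = 0"
proof (cases j)
  case (Inl i)
  then have "i \<notin> {..<nat \<lceil>width m\<rceil>}" using j unfolding choice_support_def by blast
  then have "nat \<lceil>width m\<rceil> \<le> i" by (simp only: lessThan_iff not_less)
  then have "width m \<le> real i" using real_nat_ceiling_ge[of "width m"] by linarith
  moreover have "width (m - 1) \<le> width m" using width_step(2)[of "m - 1"] m by simp
  ultimately show ?thesis using Inl by (simp add: choice_coords_def ramp_gap_zero)
qed (use j in \<open>auto simp: choice_coords_def choice_support_def\<close>)

lemma sum_choice_support:
  "(\<Sum>j\<in>choice_support m. h j) = (\<Sum>i<nat \<lceil>width m\<rceil>. h (Inl i)) + (h (Inr m) :: real)"
  unfolding choice_support_def by (subst sum.union_disjoint) (auto simp: sum.reindex)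

lemma residual_choice_product:
  "(\<Sum>j\<in>choice_support m. residual_coords n j * choice_coords m j) =
     (height n * height (m - 1) * (\<Sum>i<nat \<lceil>width m\<rceil>. ramp (width n) i * ramp_gap (width (m - 1)) (width m) i)
       + (if n < m then (stock m)\<^sup>2 else 0)) / step m"
  by (simp add: sum_choice_support residual_coords_def choice_coords_def add_divide_distrib
      sum_distrib_left sum_divide_distrib power2_eq_square mult_ac)

lemma choice_unit:
  assumes "1 \<le> m"
  shows "(\<Sum>j\<in>choice_support m. choice_coords m j * choice_coords m j) = 1"
proof -
  have "(\<Sum>j\<in>choice_support m. choice_coords m j * choice_coords m j) = (drift m + (stock m)\<^sup>2) / (step m)\<^sup>2"
    by (simp add: sum_choice_support choice_coords_def drift_def ramp_loss_def add_divide_distrib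
        sum_distrib_left sum_divide_distrib power2_eq_square mult_ac)
  then show ?thesis using step_pos[OF assms] by (simp add: step_sq[symmetric])
qed

lemma residual_next_choice:
  "(\<Sum>j\<in>choice_support (Suc n). residual_coords n j * choice_coords (Suc n) j) = step (Suc n)"
proof -
  have "(\<Sum>j\<in>choice_support (Suc n). residual_coords n j * choice_coords (Suc n) j)
      = (drift (Suc n) + (stock (Suc n))\<^sup>2) / step (Suc n)"
    unfolding residual_choice_product
    by (simp add: ramp_gap_inner[OF width_step] drift_def power2_eq_square)
  then show ?thesis using step_pos[of "Suc n"] unfolding step_sq[symmetric] by (simp add: power2_eq_square)
qed

text \<open>The chosen direction \<open>m\<close> is the normalised sum of an advance and of \<open>stock
  m\<close> times a fresh vector. The advance contributes at most \<open>4 * height n\<close> by the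
  estimate on gaps. The fresh vector contributes at most \<open>stock m \<le> 8 * t m * height n\<close>,
  and only when \<open>m > n\<close>, where the heights decrease in the right direction. If the front moves,
  \<open>t m \<le> 1 / 2\<close> and the two parts add up to \<open>8 * height n\<close>; if it rests, the
  first part vanishes.\<close>

lemma residual_choice_bound:
  assumes m: "1 \<le> m"
  shows "\<bar>\<Sum>j\<in>choice_support m. residual_coords n j * choice_coords m j\<bar> \<le> 8 * height n"
proof -
  obtain l where l: "m = Suc l" using m by (cases m) auto
  define X where "X = height l * (\<Sum>i<nat \<lceil>width m\<rceil>. ramp (width n) i * ramp_gap (width l) (width m) i)"
  define Y where "Y = (if n < m then (stock m)\<^sup>2 else 0)"
  have prod: "(\<Sum>j\<in>choice_support m. residual_coords n j * choice_coords m j) = (height n * X + Y) / step m"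
    unfolding residual_choice_product by (simp add: X_def Y_def l mult.assoc)
  have X: "\<bar>X\<bar> \<le> 4 * sqrt (drift m)"
  proof -
    have "\<bar>X\<bar> \<le> height l * (4 * sqrt (ramp_loss (width l) (width m)))"
      unfolding X_def abs_mult l
      using height_pos[of l] ramp_gap_inner_bound[of "width l" "width (Suc l)" "width n", OF width_step]
      by (intro mult_mono) auto
    also have "\<dots> = 4 * sqrt (drift m)" using height_pos[of l] by (simp add: drift_def l real_sqrt_mult)
    finally show ?thesis .
  qed
  have step: "0 < step m" by (rule step_pos[OF m])
  have Y_nonneg: "0 \<le> Y" by (simp add: Y_def)
  have Y: "Y / step m \<le> 8 * t m * height n"
  proof (cases "n < m")
    case True
    have "(stock m)\<^sup>2 / step m \<le> stock m"
      using stock_le_step[of m] stock_nonneg[OF m] step by (simp add: power2_eq_square divide_le_eq mult_left_mono)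
    also have "\<dots> \<le> 8 * t m * height n"
      unfolding stock_def using t[OF m] True l height_antimono[of n l] by (intro mult_left_mono) auto
    finally show ?thesis using True by (simp add: Y_def)
  next
    case False
    then show ?thesis using t[OF m] height_pos[of n] by (simp add: Y_def)
  qed
  have abs: "\<bar>(height n * X + Y) / step m\<bar> \<le> height n * (\<bar>X\<bar> / step m) + Y / step m"
  proof -
    have "\<bar>height n * X + Y\<bar> \<le> height n * \<bar>X\<bar> + Y"
      using abs_triangle_ineq[of "height n * X" Y] height_pos[of n] Y_nonneg by (simp add: abs_mult)
    then show ?thesis using step by (simp add: add_divide_distrib[symmetric] divide_right_mono)
  qed
  show ?thesis
  proof (cases "s m = 0")
    case True
    then have "ramp_loss (width l) (width m) \<le> 0" using ramp_loss_le[OF width_step, of l] by (simp add: l width_Suc)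
    then have "drift m \<le> 0" by (simp add: drift_def l mult_nonneg_nonpos)
    then have "X = 0" using X drift_nonneg[of m] by simp
    moreover have "8 * t m * height n \<le> 8 * height n" using t[OF m] height_pos[of n] by simp
    ultimately show ?thesis using abs Y unfolding prod by simp
  next
    case False
    then have "t m \<le> 1 / 2" using moving s_nonneg[of m] by simp
    then have "8 * t m * height n \<le> 4 * height n" using height_pos[of n] by simp
    moreover have "height n * (\<bar>X\<bar> / step m) \<le> height n * 4"
      using X sqrt_drift_le_step[of m] step height_pos[of n]
      by (intro mult_left_mono) (auto simp: divide_le_eq)
    ultimately show ?thesis using abs Y unfolding prod by linarith
  qed
qed

lemma residual_coords_Suc:
  "residual_coords n j - step (Suc n) * choice_coords (Suc n) j = residual_coords (Suc n) j"
proof (cases j)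
  case (Inl i)
  have "step (Suc n) * (height n * ramp_gap (width n) (width (Suc n)) i / step (Suc n))
      = height n * ramp_gap (width n) (width (Suc n)) i"
    using step_pos[of "Suc n"] by simp
  then show ?thesis by (simp add: Inl residual_coords_def choice_coords_def ramp_gap_def algebra_simps)
next
  case (Inr k)
  then show ?thesis
    using step_pos[of "Suc n"] by (cases "k = Suc n") (auto simp: residual_coords_def choice_coords_def)
qed

lemma residual_coords_bound: "\<bar>residual_coords n j\<bar> \<le> 8 * height n"
proof (cases j)
  case (Inl i)
  have "height n * ramp (width n) i \<le> height n" using height_pos[of n] ramp_le_1 by (simp add: mult_left_le)
  then show ?thesis using Inl height_pos[of n] ramp_nonneg[of "width n" i] by (simp add: residual_coords_def abs_mult)
next
  case (Inr k)
  show ?thesis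
  proof (cases "n < k")
    case True
    then have "stock k \<le> 8 * (1 * height n)"
      unfolding stock_def mult.assoc using t[of k] height_antimono[of n "k - 1"] height_pos[of "k - 1"]
      by (intro mult_left_mono mult_mono) auto
    then show ?thesis using Inr True stock_nonneg[of k] by (simp add: residual_coords_def)
  qed (use Inr height_pos[of n] in \<open>simp add: residual_coords_def\<close>)
qed

lemma residual_coords_summable: "(\<lambda>j. (residual_coords n j)\<^sup>2) summable_on UNIV"
proof -
  have "(\<lambda>i. (residual_coords n (Inl i))\<^sup>2) summable_on {..<nat \<lceil>width n\<rceil>}" by simp
  then have "(\<lambda>i. (residual_coords n (Inl i))\<^sup>2) summable_on UNIV"
  proof (rule summable_on_cong_neutral[THEN iffD1, rotated -1])
    fix i assume "i \<in> UNIV - {..<nat \<lceil>width n\<rceil>}"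
    then have "width n \<le> real i" using real_nat_ceiling_ge[of "width n"] by auto
    then show "(residual_coords n (Inl i))\<^sup>2 = 0" by (simp add: residual_coords_def ramp_zero)
  qed auto
  then have L: "(\<lambda>j. (residual_coords n j)\<^sup>2) summable_on range Inl"
    by (subst summable_on_reindex) (auto simp: o_def)
  have "summable (\<lambda>k. (stock k)\<^sup>2)" using summable_stock by (subst (asm) summable_Suc_iff)
  then have "summable (\<lambda>k. (residual_coords n (Inr k))\<^sup>2)"
    by (rule summable_comparison_test'[where N = 0]) (auto simp: residual_coords_def)
  then have "(\<lambda>k. (residual_coords n (Inr k))\<^sup>2) summable_on UNIV"
    by (intro norm_summable_imp_summable_on) simp
  then have R: "(\<lambda>j. (residual_coords n j)\<^sup>2) summable_on range Inr"
    by (subst summable_on_reindex) (auto simp: o_def)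
  have "(\<lambda>j. (residual_coords n j)\<^sup>2) summable_on (range Inl \<union> range Inr)"
    by (rule summable_on_Un_disjoint[OF L R]) auto
  then show ?thesis by (simp only: UNIV_sum)
qed

end

locale spreading_counterexample = spreading_schedule t s + l2_copy K J
  for t s and K and J :: "(nat + nat \<Rightarrow> complex) \<Rightarrow> 'a"
begin

definition target where "target = real_vector (residual_coords 0)"
definition choices where "choices n = real_vector (choice_coords n)"
definition atoms where "atoms = range basis \<union> choices ` {1..}"

lemma choices_in_carrier: "1 \<le> n \<Longrightarrow> choices n \<in> carrier l2_space"
  unfolding choices_def by (rule real_vector_finite_support[OF finite_choice_support]) (rule choice_coords_outside)

lemma inner_choices:
  "1 \<le> m \<Longrightarrow> l2_inner (real_vector g) (choices m) = complex_of_real (\<Sum>j\<in>choice_support m. g j * choice_coords m j)"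
  unfolding choices_def by (rule inner_real_vector[OF finite_choice_support]) (rule choice_coords_outside)

lemma dictionary_atoms: "dictionary atoms"
proof (rule dictionary_if_contains_basis)
  have "hnorm (choices n) = 1" if "1 \<le> n" for n
    using inner_choices[OF that, of "choice_coords n"] choice_unit[OF that] by (simp add: hnorm_def choices_def)
  then show "atoms \<subseteq> {g \<in> carrier l2_space. hnorm g = 1}"
    using choices_in_carrier basis_in_carrier hnorm_basis unfolding atoms_def by blast
qed (simp add: atoms_def)

lemma residual_vector_in_carrier: "real_vector (residual_coords n) \<in> carrier l2_space"
  by (rule real_vector_in_carrier[OF residual_coords_summable])

lemma residual_eq: "residual target choices n = real_vector (residual_coords n)"
proof (induction n)
  case (Suc n)
  have ip: "l2_inner (real_vector (residual_coords n)) (choices (Suc n)) = complex_of_real (step (Suc n))"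
    by (simp add: inner_choices residual_next_choice)
  have "residual target choices (Suc n)
      = real_vector (residual_coords n) \<ominus>\<^bsub>l2_space\<^esub> complex_of_real (step (Suc n)) \<odot>\<^bsub>l2_space\<^esub> choices (Suc n)"
    unfolding residual.simps Suc.IH ip ..
  also have "\<dots> = J (\<lambda>j. complex_of_real (residual_coords n j - step (Suc n) * choice_coords (Suc n) j))"
  proof -
    have in_l2: "x \<in> l2_vectors K" if "J x \<in> carrier l2_space" for x
      using that inj by (auto simp: inj_eq)
    have "complex_of_real (step (Suc n)) \<odot>\<^bsub>l2_space\<^esub> choices (Suc n) = J (\<lambda>j. complex_of_real (step (Suc n) * choice_coords (Suc n) j))"
      by (simp add: choices_def real_vector_def)
    moreover have "complex_of_real (step (Suc n)) \<odot>\<^bsub>l2_space\<^esub> choices (Suc n) \<in> carrier l2_space"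
      by (intro smult_in choices_in_carrier K_closed) simp
    ultimately show ?thesis
      using minus_J[OF in_l2 in_l2] residual_vector_in_carrier[of n]
      by (simp del: l2_space_simps add: real_vector_def)
  qed
  also have "\<dots> = real_vector (residual_coords (Suc n))"
    by (simp only: residual_coords_Suc real_vector_def)
  finally show ?case .
qed (simp add: target_def)

text \<open>All inner products of the residual are at most \<open>8 * height (n - 1)\<close>, and \<open>t
  n\<close> times this bound is \<open>stock n\<close>, which is at most the coefficient actually
  taken.\<close>

lemma weak_greedy: "weak_greedy_choice t atoms target choices"
  unfolding weak_greedy_choice_def
proof (intro allI impI conjI)
  fix n :: nat assume n: "1 \<le> n"
  show "choices n \<in> atoms" using n by (simp add: atoms_def)
  let ?r = "residual target choices (n - 1)"
  have "cmod (l2_inner ?r g) \<le> 8 * height (n - 1)" if "g \<in> atoms" for g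
  proof -
    from that consider i where "g = basis i" | m where "1 \<le> m" "g = choices m" by (auto simp: atoms_def)
    then show ?thesis
    proof cases
      case 1
      then have "l2_inner ?r g = complex_of_real (residual_coords (n - 1) i)"
        unfolding residual_eq 1 basis_def by (subst inner_real_vector[of "{i}"]) auto
      then show ?thesis using residual_coords_bound by simp
    next
      case 2
      then show ?thesis
        unfolding residual_eq 2(2) inner_choices[OF 2(1)] norm_of_real by (intro residual_choice_bound)
    qed
  qed
  then have "(SUP g\<in>atoms. cmod (l2_inner ?r g)) \<le> 8 * height (n - 1)"
    by (intro cSUP_least) (auto simp: atoms_def)
  then have "t n * (SUP g\<in>atoms. cmod (l2_inner ?r g)) \<le> t n * (8 * height (n - 1))"
    using t[OF n] by (intro mult_left_mono) auto
  also have "\<dots> \<le> step n" using stock_le_step[of n] by (simp add: stock_def mult_ac)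
  also have "step n = cmod (l2_inner ?r (choices n))"
    unfolding residual_eq using n step_pos[OF n] residual_next_choice[of "n - 1"] by (simp add: inner_choices)
  finally show "t n * (SUP g\<in>atoms. cmod (l2_inner ?r g)) \<le> cmod (l2_inner ?r (choices n))" .
qed

lemma mass_le_hnorm: "mass n \<le> (hnorm (residual target choices n))\<^sup>2"
proof -
  have "mass n = (\<Sum>j\<in>Inl ` {..<nat \<lceil>width n\<rceil>}. (residual_coords n j)\<^sup>2)"
    by (simp add: mass_def ramp_prod_def sum.reindex residual_coords_def sum_distrib_left power2_eq_square mult_ac)
  also have "\<dots> \<le> (\<Sum>\<^sub>\<infinity>j. (residual_coords n j)\<^sup>2)"
    by (intro finite_sum_le_infsum residual_coords_summable) auto
  also have "\<dots> = (hnorm (residual target choices n))\<^sup>2"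
  proof -
    have "(\<lambda>j. complex_of_real (residual_coords n j)) \<in> l2_vectors K"
      using residual_coords_summable by (auto simp: l2_vectors_def K_closed)
    then show ?thesis by (simp add: residual_eq real_vector_def hnorm_J infsum_nonneg)
  qed
  finally show ?thesis .
qed

lemma not_convergent: "\<not> wga_converges_in t"
proof
  assume "wga_converges_in t"
  then have "limitin mtopology (approximant target choices) target sequentially"
    using dictionary_atoms weak_greedy residual_vector_in_carrier unfolding wga_converges_in_def target_def by blast
  then have "(\<lambda>n. hnorm (residual target choices n)) \<longlonglongrightarrow> 0"
    using limitin_approximant_iff[of target choices] residual_vector_in_carrier choices_in_carrier
    unfolding target_def by blast
  then have lim: "(\<lambda>n. (hnorm (residual target choices n))\<^sup>2) \<longlonglongrightarrow> 0\<^sup>2" by (intro tendsto_intros)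
  obtain \<rho> where \<rho>: "0 < \<rho>" "\<forall>\<^sub>F n in sequentially. \<rho> \<le> mass n" using mass_bounded_below by blast
  have "\<forall>\<^sub>F n in sequentially. (hnorm (residual target choices n))\<^sup>2 < \<rho>"
    using lim by (rule order_tendstoD) (use \<rho> in simp)
  then have "\<forall>\<^sub>F n in sequentially. False"
    using \<rho>(2)
  proof eventually_elim
    case (elim n)
    then show ?case using mass_le_hnorm[of n] by linarith
  qed
  then show False by simp
qed

end

section \<open>The criterion\<close>

theorem theorem2:
  fixes t :: "nat \<Rightarrow> real" and K :: "complex set" and universe_embedding :: "real \<Rightarrow> 'a"
  assumes "\<And>j. j \<ge> 1 \<Longrightarrow> 0 \<le> t j \<and> t j \<le> 1"
    and "K = \<real> \<or> K = UNIV"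
    and "inj universe_embedding"
  shows
    "(wga_converges TYPE('a) K t \<longleftrightarrow>
       \<not> summable (\<lambda>n. sqrt ((1 / 2 ^ n) * (\<Sum>k = 2 ^ n..2 ^ (n + 1) - 1. (t k)\<^sup>2))))
     \<and> (wga_converges TYPE('a) K t \<longleftrightarrow>
       \<not> summable (\<lambda>m. let n = m + 1 in
            (1 + real n * (\<Sum>k = 1..n. (t k)\<^sup>2)) powr (- 1 / 2) * (t n)\<^sup>2))
     \<and> (wga_converges TYPE('a) K t \<longleftrightarrow>
       \<not> summable (\<lambda>m. let n = m + 1 in
            1 / sqrt (real n) *
              (sqrt (\<Sum>k = 1..n. (t k)\<^sup>2) - sqrt (\<Sum>k = 1..n - 1. (t k)\<^sup>2))))"
proof -
  note t = assms(1)
  have converges: "wga_converges TYPE('a) K t \<longleftrightarrow> \<not> summable (block_rms t)"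
  proof
    assume "\<not> summable (block_rms t)"
    then show "wga_converges TYPE('a) K t"
      unfolding wga_converges_def
      by (intro allI impI hilbert_space.wga_converges_in_if_not_summable t)
  next
    assume conv: "wga_converges TYPE('a) K t"
    show "\<not> summable (block_rms t)"
    proof
      assume "summable (block_rms t)"
      obtain s where "spreading_schedule t s"
      proof (rule spreading_schedule_exists[of t, OF t \<open>summable (block_rms t)\<close>])
        fix s :: "nat \<Rightarrow> real"
        assume "\<And>n. 0 \<le> s n" "\<And>n. s n \<le> 1" "\<And>n. 0 < s n \<Longrightarrow> t n \<le> 1 / 2"
          "\<And>n. 1 \<le> n \<Longrightarrow> 0 < s n \<or> 0 < t n"
          "summable (\<lambda>m. ((s (m + 1))\<^sup>2 + (t (m + 1))\<^sup>2) / (8 + sum s {1..m}))"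
        with t have "spreading_schedule t s" by (rule spreading_schedule.intro)
        then show thesis by (rule that)
      qed
      moreover obtain J :: "(nat + nat \<Rightarrow> complex) \<Rightarrow> real" where "inj J" by (rule inj_coordinates_into_reals)
      then have "inj (universe_embedding \<circ> J)" using assms(3) by (intro inj_compose)
      then have "l2_copy K (universe_embedding \<circ> J)" using assms(2) by (intro l2_copy.intro)
      ultimately interpret spreading_counterexample t s K "universe_embedding \<circ> J"
        by (rule spreading_counterexample.intro)
      show False using conv not_convergent hilbert_space_axioms unfolding wga_converges_def by blast
    qed
  qed
  have 2: "block_rms t = (\<lambda>n. sqrt ((1 / 2 ^ n) * (\<Sum>k = 2 ^ n..2 ^ (n + 1) - 1. (t k)\<^sup>2)))"
    by (rule ext) (simp add: block_rms_def dyadic_block_def)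
  have 4: "summable (block_rms t) \<longleftrightarrow> summable (\<lambda>m. let n = m + 1 in
            1 / sqrt (real n) * (sqrt (\<Sum>k = 1..n. (t k)\<^sup>2) - sqrt (\<Sum>k = 1..n - 1. (t k)\<^sup>2)))"
    using summable_weighted_increment_iff[of t] unfolding weighted_increment_def energy_def Let_def by simp
  have 3: "summable (block_rms t) \<longleftrightarrow> summable (\<lambda>m. let n = m + 1 in
            (1 + real n * (\<Sum>k = 1..n. (t k)\<^sup>2)) powr (- 1 / 2) * (t n)\<^sup>2)"
    using summable_energy_weighted_iff[of t] summable_weighted_increment_iff[of t] unfolding energy_def Let_def by simp
  show ?thesis using converges 3 4 unfolding 2 by blast
qed

end
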